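(* Let $n$ be a positive integer. (A) Let $C_{A_n}$ be the set of all cycles of $\theta$ formed by elements of $A_n$, and let $v, w, p_i, r_i, e_i, H, C_h, l_h, N_{h_i}$ be the data attached to $\pi_5^n - 1$ as in the context. Then $C_{A_n} = \bigcup_{h \in H} C_h$, and for every non-zero $h = (h_1,\dots,h_w) \in H$, $$|C_h| = \frac{1}{2 l_h} \left(\prod_{i=1}^{v} N_{h_i}\right) \cdot \left(\prod_{i=v+1}^{w} \varphi(p_i^{h_i})\right),$$ where $\varphi$ is Euler's totient function and $l_h$ is the (common) length of the cycles in $C_h$. (B) Let $C_{B_n}$ be the set of all cycles of $\theta$ formed by elements of $B_n$, and let $v, w, p_i, r_i, e_i, H, C_h, l_h, N_{h_i}$ be the data attached to $\pi_5^n + 1$ as in the context. Then $C_{B_n} = \bigcup_{h \in H} C_h$, and for every non-zero $h \in H$ the same formula for $|C_h|$ holds.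
   Context: **The map and cycles.** Let $\mathbf{P}^1(\mathbf{F}_{5^n}) = \mathbf{F}_{5^n} \cup \{\infty\}$, and let $\theta(x) = x + x^{-1}$ for $x \neq 0,\infty$, $\theta(0)=\theta(\infty)=\infty$. An element $\gamma$ is periodic if $\theta^k(\gamma)=\gamma$ for some $k \geq 1$; if $l$ is the smallest such $k$, the cycle of length $l$ containing $\gamma$ is $\{\theta^i(\gamma) : 0 \leq i < l\}$. **The curve.** $E$ is the elliptic curve $y^2=x^3+x$ over $\mathbf{F}_5$, with point at infinity $O$, whose $x$-coordinate is by convention $\infty$. The ring $R = \mathrm{End}_{\mathbf{F}_5}(E)$ is identified with $\mathbf{Z}[i]$ so that the Frobenius endomorphism $\pi_5 : (x,y) \mapsto (x^5,y^5)$ is $1+2i$ and the isogeny $(x,y) \mapsto \left(\frac{x^2+1}{x}, y\,\frac{x^2-1}{x^2}\right)$ is $\rho = -1+i$. **The sets.** $A_n = \{x \in \mathbf{F}_{5^n} : (x,y)\in E(\mathbf{F}_{5^n}) \text{ for some } y \in \mathbf{F}_{5^n}\}\cup\{\infty\}$. Let $B_n' = \{x \in \mathbf{F}_{5^n} : (x,y) \in E(\mathbf{F}_{5^{2n}}) \text{ for some } y \in \mathbf{F}_{5^{2n}}\setminus\mathbf{F}_{5^n}\}$; then $B_n = B_n'\setminus\{1,-1\}$ if $n$ is odd and $B_n = B_n'$ if $n$ is even. Put $E(\mathbf{F}_{5^{2n}})_{B_n} = \{(x,y) \in E(\mathbf{F}_{5^{2n}}) : x \in B_n,\ y \in \mathbf{F}_{5^{2n}}\setminus\mathbf{F}_{5^n}\}$.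 Let $E(\mathbf{F}_{5^{2n}})_{B_n}^*$ be $\{O,(0,0),(2,0),(3,0),(1,\pm\widetilde\alpha),(-1,\pm\widetilde\beta)\}$ if $n$ is odd (where $\widetilde\alpha,\widetilde\beta\in\mathbf{F}_{25}$, $\widetilde\alpha^2=2$, $\widetilde\beta^2=-2$) and $\{O,(0,0),(2,0),(3,0)\}$ if $n$ is even. **The isomorphisms.** There are isomorphisms of $R$-modules $\psi : E(\mathbf{F}_{5^n}) \to R/(\pi_5^n-1)R$ and $\widetilde\psi : E(\mathbf{F}_{5^{2n}})_{B_n} \cup E(\mathbf{F}_{5^{2n}})_{B_n}^* \to R/(\pi_5^n+1)R$ (the domain of $\widetilde\psi$ is the kernel of $\pi_5^n+1$); these are fixed. **Data attached to $\pi_5^n-1$ (resp. $\pi_5^n+1$).** Factor this element in $R=\mathbf{Z}[i]$, up to a unit, as $$\rho^{e_0}\cdot\prod_{i=1}^v p_i^{e_i}\cdot\prod_{i=v+1}^w r_i^{e_i},$$ where the $p_i$ ($1\le i\le v$) are distinct rational primes that are prime in $R$ (so $N(p_i^{e_i}) = p_i^{2e_i}$), and the $r_i$ ($v+1\le i\le w$) are pairwise non-associated primes of $R$ not in $\mathbf{Z}$, not associated to $\rho$, with $r_i\overline{r_i}=p_i$ a rational prime (the $p_i$ for $i > v$ need not be distinct). By the Chinese remainder theorem identify $R/(\pi_5^n-1)R$ (resp. $R/(\pi_5^n+1)R$) with $$R/\rho^{e_0}R\times\prod_{i=1}^v R/p_i^{e_i}R\times\prod_{i=v+1}^w R/r_i^{e_i}R.$$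 For $1 \le i \le v$ and $0\le h_i\le e_i$ set $N_{h_i}=1$ if $h_i=0$ and $N_{h_i}=p_i^{2h_i}-p_i^{2(h_i-1)}$ otherwise. Let $H=\prod_{i=1}^w\{0,1,\dots,e_i\}$. For $h=(h_1,\dots,h_w)\in H$, let $C_h$ be the set of all cycles formed by the elements $x\in A_n$ (resp. $x\in B_n$) that are the $x$-coordinate of a point $T \in E(\mathbf{F}_{5^n})$ (resp. $T\in E(\mathbf{F}_{5^{2n}})_{B_n}$) with $\psi(T)$ (resp. $\widetilde\psi(T)$) of the form $(0,P_1,\dots,P_w)$, where each $P_i$ has additive order $p_i^{h_i}$ in $R/p_i^{e_i}R$ (for $1\le i\le v$) or in $R/r_i^{e_i}R$ (for $v+1\le i\le w$). Let $l_h$ be the length of the cycles formed by these elements. *)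

theory Defs
  imports
    "HOL-Algebra.Module"
    "HOL-Algebra.QuotRing"
    "HOL-Algebra.Ring_Divisibility"
    "HOL-Algebra.Multiplicative_Group"
    "HOL-Computational_Algebra.Computational_Algebra"
    "HOL-Number_Theory.Totient"
begin

text \<open>
  All finite fields live inside one algebraically closed field \<open>'a\<close> of characteristic 5, whose
  subfield with \<open>5 ^ n\<close> elements is the set of roots of \<open>x ^ (5 ^ n) = x\<close>.
\<close>

definition Fq :: "nat \<Rightarrow> 'a::field set" where
  "Fq n = {x. x ^ (5 ^ n) = x}"


section \<open>The map theta and its cycles\<close>

datatype 'a proj_line = Fin 'a | Inf

fun theta :: "'a::field proj_line \<Rightarrow> 'a proj_line" where
  "theta Inf = Inf"
| "theta (Fin x) = (if x = 0 then Inf else Fin (x + inverse x))"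

definition periodic :: "'a::field proj_line \<Rightarrow> bool" where
  "periodic g \<longleftrightarrow> (\<exists>k\<ge>1. (theta ^^ k) g = g)"

definition period :: "'a::field proj_line \<Rightarrow> nat" where
  "period g = (LEAST k. k \<ge> 1 \<and> (theta ^^ k) g = g)"

definition cycle_of_length :: "nat \<Rightarrow> 'a::field proj_line set \<Rightarrow> bool" where
  "cycle_of_length l c \<longleftrightarrow>
     (\<exists>g. periodic g \<and> l = period g \<and> c = {(theta ^^ i) g | i. i < l})"

definition cycles_in :: "'a::field proj_line set \<Rightarrow> 'a proj_line set set" where
  "cycles_in S = {c. (\<exists>l. cycle_of_length l c) \<and> c \<subseteq> S}"


section \<open>The elliptic curve\<close>

datatype 'a point = Infpt | Aff 'a 'a

fun xcoord :: "'a point \<Rightarrow> 'a proj_line" where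
  "xcoord Infpt = Inf"
| "xcoord (Aff x y) = Fin x"

text \<open>The points with coordinates in a subfield \<open>F\<close>.\<close>

definition curve :: "'a::field set \<Rightarrow> 'a point set" where
  "curve F = insert Infpt {Aff x y | x y. x \<in> F \<and> y \<in> F \<and> y ^ 2 = x ^ 3 + x}"

text \<open>
  The chord-tangent law. If two points of the curve have the same abscissa and are not opposite,
  they are equal, so the tangent slope applies.
\<close>

fun ell_add :: "'a::field point \<Rightarrow> 'a point \<Rightarrow> 'a point" where
  "ell_add Infpt Q = Q"
| "ell_add P Infpt = P"
| "ell_add (Aff x1 y1) (Aff x2 y2) =
     (if x1 = x2 \<and> y1 = - y2 then Infpt
      else let s = (if x1 = x2 then (3 * x1 ^ 2 + 1) / (2 * y1) else (y2 - y1) / (x2 - x1));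
               x3 = s ^ 2 - x1 - x2
           in Aff x3 (s * (x1 - x3) - y1))"

fun frob5 :: "'a::field point \<Rightarrow> 'a point" where
  "frob5 Infpt = Infpt"
| "frob5 (Aff x y) = Aff (x ^ 5) (y ^ 5)"

fun rho_map :: "'a::field point \<Rightarrow> 'a point" where
  "rho_map Infpt = Infpt"
| "rho_map (Aff x y) =
     (if x = 0 then Infpt else Aff ((x ^ 2 + 1) / x) (y * ((x ^ 2 - 1) / x ^ 2)))"


section \<open>The endomorphism ring and its identification with the Gaussian integers\<close>

text \<open>
  The function field of the curve over \<open>Fq 1\<close> is generated by \<open>y\<close> over the rational functions in
  \<open>x\<close>, with \<open>y\<close> quadratic, so every pair of rational functions on the curve can be written as below
  with a common denominator \<open>d\<close>. A group endomorphism is determined by its values outside the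
  finitely many zeros of \<open>d\<close>.
\<close>

definition rational_over_F5 :: "('a::alg_closed_field point \<Rightarrow> 'a point) \<Rightarrow> bool" where
  "rational_over_F5 f \<longleftrightarrow>
     (\<exists>a b a' b' d :: 'a poly.
        (\<forall>q\<in>{a, b, a', b', d}. \<forall>i. Polynomial.coeff q i \<in> Fq 1) \<and> d \<noteq> 0 \<and>
        (\<forall>x y. Aff x y \<in> curve UNIV \<and> poly d x \<noteq> 0 \<longrightarrow>
           f (Aff x y) = Aff ((poly a x + poly b x * y) / poly d x)
                             ((poly a' x + poly b' x * y) / poly d x)))"

definition curve_group :: "'a::field set \<Rightarrow> 'a point monoid" where
  "curve_group F = \<lparr>carrier = curve F, monoid.mult = ell_add, one = Infpt\<rparr>"

definition End_F5 :: "('a::alg_closed_field point \<Rightarrow> 'a point) ring" where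
  "End_F5 =
     \<lparr>carrier = {f \<in> extensional (curve UNIV) \<inter> hom (curve_group UNIV) (curve_group UNIV).
                  f = (\<lambda>P\<in>curve UNIV. Infpt) \<or> rational_over_F5 f},
      monoid.mult = (\<lambda>f g. compose (curve UNIV) f g),
      one = (\<lambda>P\<in>curve UNIV. P),
      zero = (\<lambda>P\<in>curve UNIV. Infpt),
      add = (\<lambda>f g. \<lambda>P\<in>curve UNIV. ell_add (f P) (g P))\<rparr>"

definition gauss_ring :: "complex ring" where
  "gauss_ring =
     \<lparr>carrier = {z. Re z \<in> \<int> \<and> Im z \<in> \<int>}, monoid.mult = (*), one = 1, zero = 0, add = (+)\<rparr>"

abbreviation pi5 :: complex where
  "pi5 \<equiv> 1 + 2 * \<i>"

abbreviation rho :: complex where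
  "rho \<equiv> - 1 + \<i>"

definition gauss_identification ::
    "(complex \<Rightarrow> 'a::alg_closed_field point \<Rightarrow> 'a point) \<Rightarrow> bool" where
  "gauss_identification \<iota> \<longleftrightarrow>
     \<iota> \<in> ring_iso gauss_ring End_F5 \<and>
     \<iota> pi5 = restrict frob5 (curve UNIV) \<and>
     \<iota> rho = restrict rho_map (curve UNIV)"


section \<open>The sets of abscissas and points\<close>

definition A_set :: "nat \<Rightarrow> 'a::field proj_line set" where
  "A_set n = insert Inf {Fin x | x. x \<in> Fq n \<and> (\<exists>y\<in>Fq n. Aff x y \<in> curve (Fq n))}"

definition B'_set :: "nat \<Rightarrow> 'a::field proj_line set" where
  "B'_set n = {Fin x | x. x \<in> Fq n \<and> (\<exists>y\<in>Fq (2 * n) - Fq n. Aff x y \<in> curve (Fq (2 * n)))}"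

definition B_set :: "nat \<Rightarrow> 'a::field proj_line set" where
  "B_set n = (if odd n then B'_set n - {Fin 1, Fin (- 1)} else B'_set n)"

definition curve_B :: "nat \<Rightarrow> 'a::field point set" where
  "curve_B n = {Aff x y | x y.
     Aff x y \<in> curve (Fq (2 * n)) \<and> Fin x \<in> B_set n \<and> y \<in> Fq (2 * n) - Fq n}"

definition curve_B_star :: "nat \<Rightarrow> 'a::field point set" where
  "curve_B_star n =
     {Infpt, Aff 0 0, Aff 2 0, Aff 3 0} \<union>
     (if odd n then {Aff 1 y | y. y \<in> Fq 2 \<and> y ^ 2 = 2} \<union> {Aff (- 1) y | y. y \<in> Fq 2 \<and> y ^ 2 = - 2}
      else {})"


section \<open>Module isomorphisms\<close>

definition module_iso ::
    "('r, 'x) ring_scheme \<Rightarrow> ('r, 'm, 'y) module_scheme \<Rightarrow> ('r, 'k, 'z) module_scheme \<Rightarrow> ('m \<Rightarrow> 'k) set"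
  where
  "module_iso R M N =
     {f. module R M \<and> module R N \<and> f \<in> iso (add_monoid M) (add_monoid N) \<and>
         (\<forall>r\<in>carrier R. \<forall>x\<in>carrier M. f (r \<odot>\<^bsub>M\<^esub> x) = r \<odot>\<^bsub>N\<^esub> f x)}"

text \<open>
  The type of modules extends that of rings; the multiplicative fields play no role for modules.
\<close>

definition point_module ::
    "(complex \<Rightarrow> 'a::field point \<Rightarrow> 'a point) \<Rightarrow> 'a point set \<Rightarrow> (complex, 'a point) module" where
  "point_module \<iota> S =
     \<lparr>carrier = S, monoid.mult = undefined, one = undefined,
      zero = Infpt, add = ell_add, module.smult = \<iota>\<rparr>"

abbreviation gauss_quot :: "complex \<Rightarrow> complex set ring" where
  "gauss_quot m \<equiv> gauss_ring Quot (PIdl\<^bsub>gauss_ring\<^esub> m)"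

definition quot_module :: "complex \<Rightarrow> (complex, complex set) module" where
  "quot_module m =
     \<lparr>carrier = carrier (gauss_quot m), monoid.mult = monoid.mult (gauss_quot m),
      one = \<one>\<^bsub>gauss_quot m\<^esub>, zero = \<zero>\<^bsub>gauss_quot m\<^esub>, add = add (gauss_quot m),
      module.smult = (\<lambda>r X. (PIdl\<^bsub>gauss_ring\<^esub> m +>\<^bsub>gauss_ring\<^esub> r) \<otimes>\<^bsub>gauss_quot m\<^esub> X)\<rparr>"


section \<open>Factorization data\<close>

definition gauss_factorization ::
    "complex \<Rightarrow> nat \<Rightarrow> nat \<Rightarrow> (nat \<Rightarrow> nat) \<Rightarrow> (nat \<Rightarrow> complex) \<Rightarrow> (nat \<Rightarrow> nat) \<Rightarrow> bool" where
  "gauss_factorization m v w p r e \<longleftrightarrow>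
     v \<le> w \<and>
     inj_on p {1..v} \<and>
     (\<forall>i\<in>{1..v}. Factorial_Ring.prime (p i) \<and> ring_prime\<^bsub>gauss_ring\<^esub> (of_nat (p i))) \<and>
     (\<forall>i\<in>{v+1..w}.
        r i \<in> carrier gauss_ring \<and> ring_prime\<^bsub>gauss_ring\<^esub> (r i) \<and> r i \<notin> \<int> \<and>
        \<not> r i \<sim>\<^bsub>gauss_ring\<^esub> rho \<and>
        r i * cnj (r i) = of_nat (p i) \<and> Factorial_Ring.prime (p i)) \<and>
     (\<forall>i\<in>{v+1..w}. \<forall>j\<in>{v+1..w}. i \<noteq> j \<longrightarrow> \<not> r i \<sim>\<^bsub>gauss_ring\<^esub> r j) \<and>
     m \<sim>\<^bsub>gauss_ring\<^esub>
       rho ^ e 0 * (\<Prod>i\<in>{1..v}. of_nat (p i) ^ e i) * (\<Prod>i\<in>{v+1..w}. r i ^ e i)"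

definition H_set :: "nat \<Rightarrow> (nat \<Rightarrow> nat) \<Rightarrow> (nat \<Rightarrow> nat) set" where
  "H_set w e = (\<Pi>\<^sub>E i\<in>{1..w}. {0..e i})"

definition N_h :: "nat \<Rightarrow> nat \<Rightarrow> nat" where
  "N_h p h = (if h = 0 then 1 else p ^ (2 * h) - p ^ (2 * (h - 1)))"

text \<open>
  For \<open>d\<close> dividing \<open>m\<close>, this sends a class \<open>z + mR\<close> to \<open>z + dR\<close>. These projections are the
  components of the isomorphism of the Chinese remainder theorem.
\<close>

definition proj_mod :: "complex \<Rightarrow> complex set \<Rightarrow> complex set" where
  "proj_mod d X = X <+>\<^bsub>gauss_ring\<^esub> PIdl\<^bsub>gauss_ring\<^esub> d"

definition prime_power ::
    "nat \<Rightarrow> (nat \<Rightarrow> nat) \<Rightarrow> (nat \<Rightarrow> complex) \<Rightarrow> (nat \<Rightarrow> nat) \<Rightarrow> nat \<Rightarrow> complex" where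
  "prime_power v p r e i = (if i \<le> v then of_nat (p i) else r i) ^ e i"

definition has_orders ::
    "nat \<Rightarrow> nat \<Rightarrow> (nat \<Rightarrow> nat) \<Rightarrow> (nat \<Rightarrow> complex) \<Rightarrow> (nat \<Rightarrow> nat) \<Rightarrow> (nat \<Rightarrow> nat) \<Rightarrow> complex set \<Rightarrow> bool"
  where
  "has_orders v w p r e h X \<longleftrightarrow>
     proj_mod (rho ^ e 0) X = \<zero>\<^bsub>gauss_quot (rho ^ e 0)\<^esub> \<and>
     (\<forall>i\<in>{1..w}.
        group.ord (add_monoid (gauss_quot (prime_power v p r e i)))
          (proj_mod (prime_power v p r e i) X) = p i ^ h i)"

text \<open>
  Here \<open>X\<close> is the set of abscissas (\<open>A_set n\<close> or \<open>B_set n\<close>), and \<open>S\<close> the set of points above it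
  (\<open>curve (Fq n)\<close> or \<open>curve_B n\<close>).
\<close>

definition C_h ::
    "'a::field proj_line set \<Rightarrow> 'a point set \<Rightarrow> ('a point \<Rightarrow> complex set) \<Rightarrow> nat \<Rightarrow> nat \<Rightarrow>
     (nat \<Rightarrow> nat) \<Rightarrow> (nat \<Rightarrow> complex) \<Rightarrow> (nat \<Rightarrow> nat) \<Rightarrow> (nat \<Rightarrow> nat) \<Rightarrow> 'a proj_line set set" where
  "C_h X S \<psi> v w p r e h =
     cycles_in {x \<in> X. \<exists>T\<in>S. xcoord T = x \<and> has_orders v w p r e h (\<psi> T)}"

end

theory Submission
  imports Defs
begin

text \<open>
  On abscissas, the endomorphism \<open>rho\<close> of the curve \<open>y ^ 2 = x ^ 3 + x\<close> induces \<open>theta\<close>, and two points have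
  the same abscissa exactly when they are equal or opposite. A module isomorphism from a set of
  points onto the quotient of the Gaussian integers by \<open>m\<close> therefore turns \<open>theta\<close> into multiplication
  by \<open>rho\<close> on the quotient, taken up to sign (\<open>cycles_of_abscissas\<close>). On the
  curve itself one only has to compute opposite points, the action of \<open>rho_map\<close>, and the exceptional
  points of the twist; the group axioms are part of the module structure.

  Split the modulus into a power of \<open>rho\<close> and powers of primes \<open>q i\<close> dividing odd rational primes
  \<open>p i\<close>. Modulo the powers of \<open>q i\<close>, \<open>rho\<close> is a unit of finite order; modulo the power of \<open>rho\<close> it is
  nilpotent. So a class is periodic up to sign exactly when its component at \<open>rho\<close> vanishes
  (\<open>periodic_iff\<close>). Multiplication by the unit \<open>rho\<close> preserves the additive orders \<open>p i ^ h i\<close> of the other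
  components, so every cycle lies in the stratum of a single \<open>h\<close> (\<open>cycles_in_X\<close>).

  The length of a cycle is the least \<open>k\<close> such that \<open>rho ^ k - 1\<close> or \<open>rho ^ k + 1\<close> annihilates the class. An
  element of order \<open>p i ^ h i\<close> modulo a power of \<open>q i\<close> has annihilator generated by \<open>q i ^ h i\<close>
  (\<open>annihilator_iff\<close>), so this length depends only on \<open>h\<close>. The classes with orders \<open>h\<close> are counted one
  component at a time by the Chinese remainder theorem (\<open>card_residues_ball\<close>, \<open>card_has_order_exponent\<close>):
  there are \<open>N ^ h i - N ^ (h i - 1)\<close> choices at \<open>q i\<close> if \<open>h i > 0\<close>, where \<open>N\<close> is the number of classes
  modulo \<open>q i\<close>, namely \<open>p i ^ 2\<close> for inert and \<open>p i\<close> for split primes. For \<open>h\<close> nonzero, opposite classes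
  are distinct because the orders are odd, so each abscissa is counted twice, and each cycle consumes
  as many abscissas as its length (\<open>card_stratum\<close>, \<open>stratum_cycles\<close>).

  For the twist, the abscissas of the exceptional points are left out of \<open>B_set n\<close>. These points are
  killed by \<open>rho ^ 3\<close>, so they occur in no stratum with nonzero \<open>h\<close>.
\<close>

section \<open>Divisibility and residues of Gaussian integers\<close>

definition gauss_int :: "complex set" where
  "gauss_int = {z. Re z \<in> \<int> \<and> Im z \<in> \<int>}"

definition gdvd :: "complex \<Rightarrow> complex \<Rightarrow> bool" (infix "gdvd" 50) where
  "a gdvd b \<longleftrightarrow> (\<exists>k\<in>gauss_int. b = a * k)"

definition comaximal :: "complex \<Rightarrow> complex \<Rightarrow> bool" where
  "comaximal a b \<longleftrightarrow> (\<exists>x\<in>gauss_int. \<exists>y\<in>gauss_int. x * a + y * b = 1)"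

text \<open>
  The class of \<open>z\<close> modulo \<open>d\<close>, as a set. It equals the coset of the principal ideal of \<open>d\<close>
  through \<open>z\<close>, which ties the quotient ring to divisibility.
\<close>

definition residue :: "complex \<Rightarrow> complex \<Rightarrow> complex set" where
  "residue d z = {z + d * k | k. k \<in> gauss_int}"

definition residues :: "complex \<Rightarrow> complex set set" where
  "residues d = residue d ` gauss_int"

lemma gauss_int_closed [simp, intro]:
  "0 \<in> gauss_int" "1 \<in> gauss_int" "\<i> \<in> gauss_int" "of_nat k \<in> gauss_int" "of_int j \<in> gauss_int"
  "numeral l \<in> gauss_int"
  "a \<in> gauss_int \<Longrightarrow> b \<in> gauss_int \<Longrightarrow> a + b \<in> gauss_int"
  "a \<in> gauss_int \<Longrightarrow> b \<in> gauss_int \<Longrightarrow> a - b \<in> gauss_int"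
  "a \<in> gauss_int \<Longrightarrow> b \<in> gauss_int \<Longrightarrow> a * b \<in> gauss_int"
  "a \<in> gauss_int \<Longrightarrow> - a \<in> gauss_int"
  "a \<in> gauss_int \<Longrightarrow> cnj a \<in> gauss_int"
  by (auto simp: gauss_int_def)

lemma gauss_int_power [simp, intro]: "a \<in> gauss_int \<Longrightarrow> a ^ k \<in> gauss_int"
  by (induction k) auto

lemma gauss_int_prod [intro]: "(\<And>i. i \<in> I \<Longrightarrow> f i \<in> gauss_int) \<Longrightarrow> (\<Prod>i\<in>I. f i) \<in> gauss_int"
  by (induction I rule: infinite_finite_induct) auto

lemma gauss_int_obtain:
  assumes "z \<in> gauss_int"
  obtains a b :: int where "z = of_int a + \<i> * of_int b"
proof -
  obtain a b :: int where "Re z = of_int a" "Im z = of_int b"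
    using assms unfolding gauss_int_def by (auto elim!: Ints_cases)
  then have "z = of_int a + \<i> * of_int b" by (simp add: complex_eq_iff)
  then show ?thesis by (rule that)
qed

lemma gdvd_refl [simp]: "a gdvd a"
  unfolding gdvd_def by (rule bexI[of _ 1]) auto

lemma gdvd_0 [simp]: "a gdvd 0"
  unfolding gdvd_def by (rule bexI[of _ 0]) auto

lemma gdvd_trans [trans]: "a gdvd b \<Longrightarrow> b gdvd c \<Longrightarrow> a gdvd c"
  unfolding gdvd_def by (force simp: mult.assoc)

lemma gdvd_mult: "a gdvd b \<Longrightarrow> c \<in> gauss_int \<Longrightarrow> a gdvd c * b"
  unfolding gdvd_def by (force simp: mult.left_commute)

lemma gdvd_mult_right: "a gdvd b \<Longrightarrow> c \<in> gauss_int \<Longrightarrow> a gdvd b * c"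
  using gdvd_mult by (simp add: mult.commute)

lemma gdvd_triv: "c \<in> gauss_int \<Longrightarrow> a gdvd a * c" "c \<in> gauss_int \<Longrightarrow> a gdvd c * a"
  by (simp_all add: gdvd_mult gdvd_mult_right)

lemma gdvd_add: "a gdvd b \<Longrightarrow> a gdvd c \<Longrightarrow> a gdvd b + c"
  unfolding gdvd_def by (force simp flip: distrib_left)

lemma gdvd_minus: "a gdvd b \<Longrightarrow> a gdvd - b"
  unfolding gdvd_def by (force simp flip: mult_minus_right)

lemma gdvd_minus_iff [simp]: "a gdvd - b \<longleftrightarrow> a gdvd b"
  using gdvd_minus by fastforce

lemma gdvd_diff: "a gdvd b \<Longrightarrow> a gdvd c \<Longrightarrow> a gdvd b - c"
  using gdvd_add[of a b "- c"] by simp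

lemma gdvd_diff_commute: "a gdvd b - c \<longleftrightarrow> a gdvd c - b"
  using gdvd_minus_iff[of a "b - c"] by simp

lemma gdvd_mult_cancel [simp]: "c \<noteq> 0 \<Longrightarrow> c * a gdvd c * b \<longleftrightarrow> a gdvd b"
  unfolding gdvd_def by auto

lemma gdvd_mult_mono: "a gdvd b \<Longrightarrow> c * a gdvd c * b"
  unfolding gdvd_def by auto

lemma gdvd_power_le: "a \<in> gauss_int \<Longrightarrow> j \<le> k \<Longrightarrow> a ^ j gdvd a ^ k"
  using gdvd_triv(1)[of "a ^ (k - j)" "a ^ j"] by (simp flip: power_add)

lemma comaximal_sym: "comaximal a b \<Longrightarrow> comaximal b a"
  unfolding comaximal_def by (metis add.commute)

lemma comaximal_gdvd:
  assumes "comaximal a b" "a' gdvd a"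
  shows "comaximal a' b"
proof -
  obtain x y k where g: "x \<in> gauss_int" "y \<in> gauss_int" "k \<in> gauss_int"
    and e: "x * a + y * b = 1" "a = a' * k"
    using assms unfolding comaximal_def gdvd_def by auto
  then have "(x * k) * a' + y * b = 1" by (simp add: algebra_simps)
  then show ?thesis unfolding comaximal_def using g by blast
qed

lemma comaximal_gdvd2: "comaximal a b \<Longrightarrow> a' gdvd a \<Longrightarrow> b' gdvd b \<Longrightarrow> comaximal a' b'"
  by (meson comaximal_gdvd comaximal_sym)

lemma comaximal_1 [simp]: "comaximal 1 b"
  unfolding comaximal_def by (rule bexI[of _ 1], rule bexI[of _ 0]) auto

lemma comaximal_mult:
  assumes "comaximal a c" "comaximal b c" "a \<in> gauss_int" "b \<in> gauss_int" "c \<in> gauss_int"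
  shows "comaximal (a * b) c"
proof -
  obtain x y x' y' where g: "x \<in> gauss_int" "y \<in> gauss_int" "x' \<in> gauss_int" "y' \<in> gauss_int"
    and e: "x * a + y * c = 1" "x' * b + y' * c = 1"
    using assms unfolding comaximal_def by auto
  have "(x * x') * (a * b) + (x * a * y' + y * x' * b + y * y' * c) * c
          = (x * a + y * c) * (x' * b + y' * c)"
    by (simp add: algebra_simps)
  also have "\<dots> = 1" by (simp only: e mult_1)
  finally show ?thesis unfolding comaximal_def using g assms by blast
qed

lemma comaximal_power:
  assumes "comaximal a b" "a \<in> gauss_int" "b \<in> gauss_int"
  shows "comaximal (a ^ k) b"
  using assms by (induction k) (auto intro: comaximal_mult)

lemma comaximal_powers:
  assumes "comaximal a b" "a \<in> gauss_int" "b \<in> gauss_int"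
  shows "comaximal (a ^ k) (b ^ l)"
  using assms by (meson comaximal_power comaximal_sym gauss_int_power)

lemma comaximal_prod:
  assumes "\<And>i. i \<in> I \<Longrightarrow> comaximal (f i) b" "\<And>i. i \<in> I \<Longrightarrow> f i \<in> gauss_int" "b \<in> gauss_int"
  shows "comaximal (\<Prod>i\<in>I. f i) b"
  using assms
  by (induction I rule: infinite_finite_induct) (auto intro: comaximal_mult gauss_int_prod)

text \<open>
  Multiply \<open>x * a + y * d = 1\<close> by \<open>z\<close>: comaximal elements are units modulo each other.
\<close>

lemma comaximal_cancel:
  assumes "comaximal a d" "d gdvd a * z" "z \<in> gauss_int"
  shows "d gdvd z"
proof -
  obtain x y where g: "x \<in> gauss_int" "y \<in> gauss_int" and e: "x * a + y * d = 1"
    using assms unfolding comaximal_def by auto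
  have "z = (x * a + y * d) * z" by (simp only: e mult_1)
  also have "\<dots> = x * (a * z) + (y * z) * d" by (simp add: algebra_simps)
  finally have z: "z = x * (a * z) + (y * z) * d" .
  have "d gdvd x * (a * z) + (y * z) * d"
    by (rule gdvd_add; rule gdvd_mult) (use g assms in auto)
  then show ?thesis using z by simp
qed

lemma comaximal_cancel_iff:
  assumes "comaximal a d" "a \<in> gauss_int" "z \<in> gauss_int"
  shows "d gdvd a * z \<longleftrightarrow> d gdvd z"
  using assms comaximal_cancel gdvd_mult by blast

lemma comaximal_mult_gdvd:
  assumes "comaximal a b" "a gdvd z" "b gdvd z" "b \<in> gauss_int"
  shows "a * b gdvd z"
proof -
  obtain k where k: "k \<in> gauss_int" "z = a * k"
    using assms unfolding gdvd_def by auto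
  then have "b gdvd k" using assms comaximal_cancel by blast
  then show ?thesis using k gdvd_mult_mono by simp
qed

lemma prod_gdvd_iff:
  assumes "finite I" "\<And>i. i \<in> I \<Longrightarrow> f i \<in> gauss_int"
    and "\<And>i j. i \<in> I \<Longrightarrow> j \<in> I \<Longrightarrow> i \<noteq> j \<Longrightarrow> comaximal (f i) (f j)" and "z \<in> gauss_int"
  shows "(\<Prod>i\<in>I. f i) gdvd z \<longleftrightarrow> (\<forall>i\<in>I. f i gdvd z)"
proof
  assume d: "(\<Prod>i\<in>I. f i) gdvd z"
  show "\<forall>i\<in>I. f i gdvd z"
  proof
    fix i assume i: "i \<in> I"
    have "f i gdvd f i * (\<Prod>j\<in>I - {i}. f j)"
      using assms by (intro gdvd_triv gauss_int_prod) auto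
    then have "f i gdvd (\<Prod>i\<in>I. f i)" using i assms(1) by (simp add: prod.remove)
    then show "f i gdvd z" using d by (rule gdvd_trans)
  qed
next
  show "\<forall>i\<in>I. f i gdvd z \<Longrightarrow> (\<Prod>i\<in>I. f i) gdvd z"
    using assms
  proof (induction I rule: finite_induct)
    case empty
    then show ?case by (auto simp: gdvd_def)
  next
    case (insert i I)
    have "comaximal (\<Prod>i\<in>I. f i) (f i)"
      using insert by (intro comaximal_prod) auto
    then show ?case
      using insert by (auto intro!: comaximal_mult_gdvd gauss_int_prod intro: comaximal_sym)
  qed
qed

lemma comaximal_of_coprime:
  assumes "coprime (a::int) b"
  shows "comaximal (of_int a) (of_int b)"
proof -
  obtain x y where "x * a + y * b = 1"
    using bezout_int[of a b] assms by auto
  then have "(of_int x :: complex) * of_int a + of_int y * of_int b = 1"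
    by (simp flip: of_int_mult of_int_add)
  then show ?thesis unfolding comaximal_def by blast
qed

lemma residue_eq_iff:
  assumes "z \<in> gauss_int" "z' \<in> gauss_int"
  shows "residue d z = residue d z' \<longleftrightarrow> d gdvd z - z'"
proof
  assume "residue d z = residue d z'"
  moreover have "z \<in> residue d z" unfolding residue_def by (auto intro: exI[of _ 0])
  ultimately show "d gdvd z - z'" unfolding residue_def gdvd_def by auto
next
  assume "d gdvd z - z'"
  then obtain k where k: "k \<in> gauss_int" "z = z' + d * k"
    unfolding gdvd_def by (auto simp: algebra_simps)
  have "z' + d * j = z + d * (j - k)" "z + d * j = z' + d * (k + j)" for j
    using k by (auto simp: algebra_simps)
  then show "residue d z = residue d z'"
    unfolding residue_def using k by blast
qed

lemma residue_self: "z \<in> residue d z"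
  unfolding residue_def by (auto intro: exI[of _ 0])

lemma residue_of_mem: "x \<in> residue d z \<Longrightarrow> z \<in> gauss_int \<Longrightarrow> d \<in> gauss_int \<Longrightarrow> x \<in> gauss_int"
  unfolding residue_def by auto

lemma residue_eqI: "x \<in> residue d z \<Longrightarrow> z \<in> gauss_int \<Longrightarrow> d \<in> gauss_int \<Longrightarrow> residue d x = residue d z"
  by (subst residue_eq_iff) (auto simp: residue_of_mem, auto simp: residue_def gdvd_def)

text \<open>
  Writing a residue modulo \<open>a * b\<close> as \<open>s + a * t\<close>, with \<open>s\<close> and \<open>t\<close> in fixed systems of representatives
  modulo \<open>a\<close> and \<open>b\<close>, is division with remainder by \<open>a\<close>.
\<close>

lemma bij_betw_residues_mult:
  assumes "a \<in> gauss_int" "b \<in> gauss_int" "a \<noteq> 0"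
  shows "\<exists>f. bij_betw f (residues a \<times> residues b) (residues (a * b))"
proof -
  \<comment> \<open>a representative of each class\<close>
  define s :: "complex set \<Rightarrow> complex" where "s X = (SOME z. z \<in> X)" for X
  have s: "s X \<in> gauss_int \<and> residue d (s X) = X" if "X \<in> residues d" "d \<in> gauss_int" for X d
  proof -
    from that obtain z where z: "z \<in> gauss_int" "X = residue d z"
      unfolding residues_def by auto
    then have "s X \<in> residue d z" unfolding s_def using residue_self someI by metis
    then show ?thesis using z that residue_of_mem residue_eqI by blast
  qed
  define f where "f = (\<lambda>(X, Y). residue (a * b) (s X + a * s Y))"
  have "inj_on f (residues a \<times> residues b)"
  proof (rule inj_onI, clarify)
    fix X Y X' Y'
    assume r: "X \<in> residues a" "Y \<in> residues b" "X' \<in> residues a" "Y' \<in> residues b"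
      and "f (X, Y) = f (X', Y')"
    then have d: "a * b gdvd (s X + a * s Y) - (s X' + a * s Y')"
      using s assms by (auto simp: f_def residue_eq_iff)
    then have "a gdvd (s X + a * s Y) - (s X' + a * s Y')"
      using gdvd_trans gdvd_triv assms by blast
    moreover have "a gdvd a * (s Y - s Y')"
      using s r assms by (intro gdvd_triv) auto
    ultimately have "a gdvd ((s X + a * s Y) - (s X' + a * s Y')) - a * (s Y - s Y')"
      by (rule gdvd_diff)
    then have "a gdvd s X - s X'" by (simp add: algebra_simps)
    then have X: "X = X'" using s r assms residue_eq_iff by metis
    then have "a * b gdvd a * (s Y - s Y')" using d by (simp add: algebra_simps)
    then have "b gdvd s Y - s Y'" using assms by simp
    then have "Y = Y'" using s r assms residue_eq_iff by metis
    with X show "X = X' \<and> Y = Y'" by simp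
  qed
  moreover have "f ` (residues a \<times> residues b) = residues (a * b)"
  proof
    show "f ` (residues a \<times> residues b) \<subseteq> residues (a * b)"
    proof clarify
      fix X Y assume "X \<in> residues a" "Y \<in> residues b"
      then have "s X + a * s Y \<in> gauss_int" using s assms by auto
      then show "f (X, Y) \<in> residues (a * b)" unfolding f_def residues_def by simp
    qed
    \<comment> \<open>division with remainder by \<open>a\<close>, then by \<open>b\<close>\<close>
    show "residues (a * b) \<subseteq> f ` (residues a \<times> residues b)"
    proof
      fix Z assume "Z \<in> residues (a * b)"
      then obtain z where z: "z \<in> gauss_int" "Z = residue (a * b) z" unfolding residues_def by auto
      let ?X = "residue a z"
      have X: "?X \<in> residues a" using z unfolding residues_def by auto
      then obtain k where k: "k \<in> gauss_int" "z - s ?X = a * k"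
        using s[OF X] z assms residue_eq_iff[of z "s ?X" a] unfolding gdvd_def by auto
      let ?Y = "residue b k"
      have Y: "?Y \<in> residues b" using k unfolding residues_def by auto
      then obtain j where j: "j \<in> gauss_int" "k - s ?Y = b * j"
        using s[OF Y] k assms residue_eq_iff[of k "s ?Y" b] unfolding gdvd_def by auto
      have "z - (s ?X + a * s ?Y) = a * (k - s ?Y)" using k by (simp add: algebra_simps)
      also have "\<dots> = (a * b) * j" using j by simp
      finally have "a * b gdvd z - (s ?X + a * s ?Y)" using j gdvd_triv by simp
      then have "Z = f (?X, ?Y)"
        unfolding f_def using z s[OF X] s[OF Y] assms by (simp add: residue_eq_iff)
      then show "Z \<in> f ` (residues a \<times> residues b)" using X Y by blast
    qed
  qed
  ultimately show ?thesis unfolding bij_betw_def by blast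
qed

lemma residues_nonempty [simp]: "residues d \<noteq> {}"
  unfolding residues_def by auto

lemma card_residues_mult:
  assumes "a \<in> gauss_int" "b \<in> gauss_int" "a \<noteq> 0"
  shows "card (residues (a * b)) = card (residues a) * card (residues b)"
  using bij_betw_residues_mult[OF assms] bij_betw_same_card card_cartesian_product by metis

lemma residues_of_nat:
  assumes "n > 0"
  shows "finite (residues (of_nat n))" "card (residues (of_nat n)) = n ^ 2"
proof -
  define f :: "int \<times> int \<Rightarrow> complex set"
    where "f = (\<lambda>(a, b). residue (of_nat n) (of_int a + \<i> * of_int b))"
  have dvd: "of_nat n gdvd of_int a + \<i> * of_int b \<longleftrightarrow> int n dvd a \<and> int n dvd b" for a b
  proof
    assume "of_nat n gdvd of_int a + \<i> * of_int b"
    then obtain k where k: "k \<in> gauss_int" "of_int a + \<i> * of_int b = of_nat n * k"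
      unfolding gdvd_def by auto
    then obtain c d where "k = of_int c + \<i> * of_int d" using gauss_int_obtain by blast
    with k have "real_of_int a = of_int (int n * c)" "real_of_int b = of_int (int n * d)"
      by (auto simp: complex_eq_iff)
    then have "a = int n * c" "b = int n * d" by linarith+
    then show "int n dvd a \<and> int n dvd b" by auto
  next
    assume "int n dvd a \<and> int n dvd b"
    then obtain c d where "a = int n * c" "b = int n * d" by (auto elim!: dvdE)
    then have "of_int a + \<i> * of_int b = of_nat n * (of_int c + \<i> * of_int d)"
      by (simp add: algebra_simps)
    then show "of_nat n gdvd of_int a + \<i> * of_int b" unfolding gdvd_def by blast
  qed
  have feq: "f (a, b) = f (a', b') \<longleftrightarrow> int n dvd a - a' \<and> int n dvd b - b'" for a b a' b'
  proof -
    have "of_int a + \<i> * of_int b - (of_int a' + \<i> * of_int b')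
        = (of_int (a - a') + \<i> * of_int (b - b') :: complex)" by (simp add: algebra_simps)
    then show ?thesis
      unfolding f_def prod.case by (subst residue_eq_iff) (simp_all only: dvd, auto)
  qed
  have "inj_on f ({0..<int n} \<times> {0..<int n})"
  proof (rule inj_onI, clarify)
    fix a b a' b'
    assume "a \<in> {0..<int n}" "b \<in> {0..<int n}" "a' \<in> {0..<int n}" "b' \<in> {0..<int n}"
      and "f (a, b) = f (a', b')"
    then show "a = a' \<and> b = b'"
      using feq by (metis atLeastLessThan_iff mod_eq_dvd_iff mod_pos_pos_trivial)
  qed
  moreover have "f ` ({0..<int n} \<times> {0..<int n}) = residues (of_nat n)"
  proof
    show "f ` ({0..<int n} \<times> {0..<int n}) \<subseteq> residues (of_nat n)"
      unfolding f_def residues_def by auto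
    show "residues (of_nat n) \<subseteq> f ` ({0..<int n} \<times> {0..<int n})"
    proof
      fix X assume "X \<in> residues (of_nat n)"
      then obtain z where z: "z \<in> gauss_int" "X = residue (of_nat n) z" unfolding residues_def by auto
      obtain a b where "z = of_int a + \<i> * of_int b" using z gauss_int_obtain by blast
      then have "X = f (a, b)" using z unfolding f_def by simp
      also have "\<dots> = f (a mod int n, b mod int n)"
        unfolding feq by (simp add: minus_mod_eq_mult_div)
      finally show "X \<in> f ` ({0..<int n} \<times> {0..<int n})" using assms by auto
    qed
  qed
  ultimately have bij: "bij_betw f ({0..<int n} \<times> {0..<int n}) (residues (of_nat n))"
    unfolding bij_betw_def by blast
  then show "finite (residues (of_nat n))" using bij_betw_finite by blast
  show "card (residues (of_nat n)) = n ^ 2"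
    using bij_betw_same_card[OF bij] by (simp add: power2_eq_square)
qed

text \<open>
  Conjugation carries classes modulo \<open>d\<close> to classes modulo \<open>cnj d\<close>. Together with multiplicativity
  and the count modulo a rational integer this gives the count modulo \<open>d\<close>, because \<open>d * cnj d\<close> is
  rational.
\<close>

lemma card_residues_cnj: "d \<in> gauss_int \<Longrightarrow> card (residues (cnj d)) = card (residues d)"
proof -
  assume d: "d \<in> gauss_int"
  have img: "(`) cnj ` residues d = residues (cnj d)" for d
  proof -
    have "cnj ` residue d z = residue (cnj d) (cnj z)" for z
    proof
      show "cnj ` residue d z \<subseteq> residue (cnj d) (cnj z)"
        unfolding residue_def by auto
      show "residue (cnj d) (cnj z) \<subseteq> cnj ` residue d z"
      proof
        fix x assume "x \<in> residue (cnj d) (cnj z)"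
        then obtain k where k: "k \<in> gauss_int" "x = cnj z + cnj d * k" unfolding residue_def by auto
        then have "x = cnj (z + d * cnj k)" by simp
        then show "x \<in> cnj ` residue d z" unfolding residue_def using k by blast
      qed
    qed
    moreover have "cnj ` gauss_int = gauss_int"
      by (metis complex_cnj_cnj gauss_int_closed(11) image_eqI image_subsetI subsetI subset_antisym)
    ultimately show ?thesis unfolding residues_def image_image
      by (metis (no_types, lifting) image_cong image_image)
  qed
  have "inj_on ((`) cnj) (residues d)"
    by (rule inj_onI) (metis complex_cnj_cnj inj_image_eq_iff inj_onI)
  then show ?thesis using card_image img by metis
qed

text \<open>
  A nonzero \<open>d\<close> divides the positive integer \<open>d * cnj d\<close>, which has finitely many residues.
\<close>

lemma cnj_mult_of_nat:
  assumes "d \<in> gauss_int" "d \<noteq> 0"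
  obtains N :: nat where "d * cnj d = of_nat N" "N > 0"
proof -
  obtain a b where ab: "d = of_int a + \<i> * of_int b" using assms gauss_int_obtain by blast
  let ?N = "nat (a ^ 2 + b ^ 2)"
  have "d * cnj d = of_int (a ^ 2 + b ^ 2)"
    unfolding ab by (simp add: complex_eq_iff power2_eq_square)
  then have 1: "d * cnj d = of_nat ?N" by (simp add: of_nat_nat)
  moreover have "?N > 0" using 1 assms by (metis complex_cnj_zero_iff gr0I mult_eq_0_iff of_nat_0)
  ultimately show ?thesis by (rule that)
qed

lemma finite_residues:
  assumes "d \<in> gauss_int" "d \<noteq> 0"
  shows "finite (residues d)"
proof -
  obtain N where N: "d * cnj d = of_nat N" "N > 0" using assms cnj_mult_of_nat by blast
  obtain f where f: "bij_betw f (residues d \<times> residues (cnj d)) (residues (d * cnj d))"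
    using bij_betw_residues_mult assms by blast
  then have "finite (residues d \<times> residues (cnj d))"
    using N residues_of_nat bij_betw_finite by metis
  then show ?thesis using finite_cartesian_productD1 by fastforce
qed

lemma card_residues_prime_norm:
  assumes "r \<in> gauss_int" "r * cnj r = of_nat p" "p > 0"
  shows "card (residues r) = p"
proof -
  have "r \<noteq> 0" using assms by auto
  then have "card (residues (of_nat p)) = card (residues r) ^ 2"
    using card_residues_mult[of r "cnj r"] card_residues_cnj assms by (simp add: power2_eq_square)
  then have "card (residues r) ^ 2 = p ^ 2" using residues_of_nat assms by simp
  then show ?thesis by simp
qed

lemma residues_unit: "residues 1 = {gauss_int}"
proof -
  have "residue 1 z = gauss_int" if z: "z \<in> gauss_int" for z
  proof
    show "residue 1 z \<subseteq> gauss_int" using z unfolding residue_def by auto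
    have "x = z + 1 * (x - z)" for x by simp
    then show "gauss_int \<subseteq> residue 1 z" using z unfolding residue_def by blast
  qed
  then have "residue 1 ` gauss_int = (\<lambda>_. gauss_int) ` gauss_int" by (intro image_cong) auto
  then show ?thesis unfolding residues_def by auto
qed

lemma card_residues_power:
  assumes "a \<in> gauss_int" "a \<noteq> 0"
  shows "card (residues (a ^ k)) = card (residues a) ^ k"
  using assms by (induction k) (simp_all add: residues_unit card_residues_mult)

section \<open>Elements of prime power order modulo a power of a prime\<close>

text \<open>
  For a prime \<open>p\<close> this says that the class of \<open>z\<close> modulo \<open>d\<close> has additive order \<open>p ^ h\<close>.
\<close>

definition has_order_exponent :: "complex \<Rightarrow> nat \<Rightarrow> nat \<Rightarrow> complex \<Rightarrow> bool" where
  "has_order_exponent d p h z \<longleftrightarrow>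
     d gdvd of_nat p ^ h * z \<and> (h = 0 \<or> \<not> d gdvd of_nat p ^ (h - 1) * z)"

lemma has_order_exponent_cong:
  assumes "d gdvd z - z'" "z \<in> gauss_int" "z' \<in> gauss_int"
  shows "has_order_exponent d p h z \<longleftrightarrow> has_order_exponent d p h z'"
proof -
  have "d gdvd a * x" if "d gdvd x - y" "d gdvd a * y" "a \<in> gauss_int" for a x y
  proof -
    have "d gdvd a * (x - y) + a * y" using that by (auto intro: gdvd_add gdvd_mult)
    then show ?thesis by (simp add: algebra_simps)
  qed
  then have "d gdvd a * z \<longleftrightarrow> d gdvd a * z'" if "a \<in> gauss_int" for a
    using that assms gdvd_diff_commute by blast
  then show ?thesis unfolding has_order_exponent_def by simp
qed

text \<open>
  Two maps that identify the same pairs of elements have equinumerous images. Several counts below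
  replace a class by an equivalent description of it in this way.
\<close>

lemma image_same_fibers:
  assumes "\<And>x y. x \<in> A \<Longrightarrow> y \<in> A \<Longrightarrow> f x = f y \<longleftrightarrow> g x = g y"
  shows "card (f ` A) = card (g ` A)" and "finite (f ` A) \<longleftrightarrow> finite (g ` A)"
proof -
  have g: "g (inv_into A f (f x)) = g x" if "x \<in> A" for x
    using assms[of "inv_into A f (f x)" x] that by (simp add: f_inv_into_f inv_into_into)
  have "bij_betw (\<lambda>X. g (inv_into A f X)) (f ` A) (g ` A)"
  proof (rule bij_betw_imageI)
    show "inj_on (\<lambda>X. g (inv_into A f X)) (f ` A)"
      using assms by (auto simp: inj_on_def g)
    show "(\<lambda>X. g (inv_into A f X)) ` f ` A = g ` A"
      unfolding image_image by (intro image_cong) (auto simp: g)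
  qed
  then show "card (f ` A) = card (g ` A)" "finite (f ` A) \<longleftrightarrow> finite (g ` A)"
    by (simp_all add: bij_betw_same_card bij_betw_finite)
qed

text \<open>
  Inert primes (\<open>q = p\<close>, \<open>c = 1\<close>) and split primes (\<open>q = r\<close>, \<open>c = cnj r\<close>) are treated at once: all
  that matters is that \<open>q\<close> is a prime factor of \<open>p\<close> whose cofactor is invertible modulo \<open>q\<close>, so that
  the powers of \<open>p\<close> and of \<open>q\<close> have the same effect modulo a power of \<open>q\<close>.
\<close>

locale odd_prime_factor =
  fixes p :: nat and q c :: complex
  assumes p: "Factorial_Ring.prime p" "odd p"
    and q [simp]: "q \<in> gauss_int" and c [simp]: "c \<in> gauss_int"
    and p_eq: "of_nat p = q * c"
    and cofactor: "comaximal c q"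
    and q_prime: "\<And>a b. a \<in> gauss_int \<Longrightarrow> b \<in> gauss_int \<Longrightarrow> q gdvd a * b \<Longrightarrow> q gdvd a \<or> q gdvd b"
    and not_unit: "\<not> q gdvd 1"
begin

lemma q_nonzero [simp]: "q \<noteq> 0"
  using p p_eq by auto

lemma comaximal_odd: "comaximal (of_int a) q" if "coprime a (int p)"
proof -
  have "comaximal (of_int a) (of_int (int p))" using that by (rule comaximal_of_coprime)
  then show ?thesis
    using comaximal_gdvd2[of "of_int a" "of_int (int p)" "of_int a" q] p_eq gdvd_triv(1)[of c q] by simp
qed

lemma comaximal_2: "comaximal 2 q"
  using comaximal_odd[of 2] p by simp

text \<open>
  \<open>rho\<close> divides 2, and 2 is invertible modulo the odd \<open>p\<close>, hence modulo \<open>q\<close>.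
\<close>

lemma comaximal_rho: "comaximal rho q"
proof (rule comaximal_gdvd[OF comaximal_2])
  show "rho gdvd 2"
    unfolding gdvd_def by (rule bexI[of _ "- 1 - \<i>"]) (auto simp: algebra_simps)
qed

lemma gdvd_p_power_iff:
  assumes "z \<in> gauss_int" "j \<le> e"
  shows "q ^ e gdvd of_nat p ^ j * z \<longleftrightarrow> q ^ (e - j) gdvd z"
proof -
  have "q ^ e gdvd of_nat p ^ j * z \<longleftrightarrow> q ^ e gdvd c ^ j * (q ^ j * z)"
    by (simp add: p_eq power_mult_distrib algebra_simps)
  also have "\<dots> \<longleftrightarrow> q ^ e gdvd q ^ j * z"
    using assms by (intro comaximal_cancel_iff comaximal_powers cofactor) auto
  also have "\<dots> \<longleftrightarrow> q ^ j * q ^ (e - j) gdvd q ^ j * z"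
    using assms by (simp flip: power_add)
  also have "\<dots> \<longleftrightarrow> q ^ (e - j) gdvd z" by simp
  finally show ?thesis .
qed

lemma gdvd_p_power_mult: "z \<in> gauss_int \<Longrightarrow> q ^ e gdvd of_nat p ^ e * z"
  by (simp add: gdvd_p_power_iff) (auto simp: gdvd_def)

lemma power_gdvd_mult_cancel:
  assumes "q ^ k gdvd a * u" "a \<in> gauss_int" "u \<in> gauss_int" "\<not> q gdvd u"
  shows "q ^ k gdvd a"
  using assms
proof (induction k arbitrary: a)
  case 0
  then show ?case by (auto simp: gdvd_def)
next
  case (Suc k)
  have "q gdvd q ^ Suc k" by (simp add: gdvd_triv)
  then have "q gdvd a * u" using Suc.prems(1) gdvd_trans by blast
  then have "q gdvd a" using q_prime Suc.prems by blast
  then obtain b where b: "b \<in> gauss_int" "a = q * b" unfolding gdvd_def by auto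
  then have "q * q ^ k gdvd q * (b * u)" using Suc.prems by (simp add: mult.assoc)
  then have "q ^ k gdvd b" using Suc b by simp
  then show ?case using b gdvd_mult_mono by simp
qed

lemma has_order_exponent_le: "has_order_exponent (q ^ e) p h z \<Longrightarrow> z \<in> gauss_int \<Longrightarrow> h \<le> e"
proof (rule ccontr)
  assume h: "has_order_exponent (q ^ e) p h z" "z \<in> gauss_int" "\<not> h \<le> e"
  then have eq: "(of_nat p :: complex) ^ (h - 1) * z = of_nat p ^ (h - 1 - e) * (of_nat p ^ e * z)"
    by (simp flip: power_add mult.assoc)
  have "q ^ e gdvd of_nat p ^ (h - 1) * z"
    unfolding eq using h by (intro gdvd_mult gdvd_p_power_mult) auto
  then show False using h unfolding has_order_exponent_def by auto
qed

lemma has_order_exponent_exists: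
  assumes "z \<in> gauss_int"
  shows "\<exists>h\<le>e. has_order_exponent (q ^ e) p h z"
proof -
  define h where "h = (LEAST h. q ^ e gdvd of_nat p ^ h * z)"
  have e: "q ^ e gdvd of_nat p ^ e * z" using assms by (rule gdvd_p_power_mult)
  have "q ^ e gdvd of_nat p ^ h * z" unfolding h_def by (rule LeastI) (rule e)
  moreover have "\<not> q ^ e gdvd of_nat p ^ (h - 1) * z" if "h \<noteq> 0"
    using that not_less_Least[of "h - 1" "\<lambda>h. q ^ e gdvd of_nat p ^ h * z"] unfolding h_def by auto
  ultimately have "has_order_exponent (q ^ e) p h z"
    unfolding has_order_exponent_def by (cases "h = 0") auto
  moreover have "h \<le> e" unfolding h_def by (rule Least_le) (rule e)
  ultimately show ?thesis by auto
qed

text \<open>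
  An element of additive order \<open>p ^ h\<close> is \<open>q ^ (e - h) * u\<close> with \<open>u\<close> prime to \<open>q\<close>, so its annihilator
  is generated by \<open>q ^ h\<close>. The additive order alone therefore decides which Gaussian integers kill
  the element; this is why all cycles with the same orders have the same length.
\<close>

lemma annihilator_iff:
  assumes h: "has_order_exponent (q ^ e) p h z" and z: "z \<in> gauss_int" and a: "a \<in> gauss_int"
  shows "q ^ e gdvd a * z \<longleftrightarrow> q ^ h gdvd a"
proof -
  have le: "h \<le> e" using h z by (rule has_order_exponent_le)
  have "q ^ (e - h) gdvd z"
    using h z le gdvd_p_power_iff unfolding has_order_exponent_def by blast
  then obtain u where u: "u \<in> gauss_int" "z = q ^ (e - h) * u" unfolding gdvd_def by auto
  have "q ^ e gdvd a * z \<longleftrightarrow> q ^ (e - h) * q ^ h gdvd q ^ (e - h) * (a * u)"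
    using le u by (simp flip: power_add) (simp add: algebra_simps)
  also have "\<dots> \<longleftrightarrow> q ^ h gdvd a * u" by simp
  also have "\<dots> \<longleftrightarrow> q ^ h gdvd a"
  proof (cases "h = 0")
    case True
    then show ?thesis using a u by (auto simp: gdvd_def)
  next
    case False
    then have "\<not> q ^ (e - (h - 1)) gdvd z"
      using h z le gdvd_p_power_iff[of z "h - 1" e] unfolding has_order_exponent_def by simp
    moreover have "q ^ (e - (h - 1)) = q ^ (e - h) * q"
      using False le by (simp flip: power_Suc2) (simp add: Suc_diff_le)
    ultimately have "\<not> q ^ (e - h) * q gdvd z" by (simp only: not_False_eq_True)
    then have "\<not> q ^ (e - h) * q gdvd q ^ (e - h) * u" unfolding u .
    then have "\<not> q gdvd u" by simp
    then show ?thesis using a u power_gdvd_mult_cancel gdvd_mult_right by blast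
  qed
  finally show ?thesis .
qed

lemma has_order_exponent_mult_iff:
  assumes "comaximal a q" "a \<in> gauss_int" "z \<in> gauss_int"
  shows "has_order_exponent (q ^ e) p h (a * z) \<longleftrightarrow> has_order_exponent (q ^ e) p h z"
proof -
  have "q ^ e gdvd of_nat p ^ j * (a * z) \<longleftrightarrow> q ^ e gdvd of_nat p ^ j * z" for j
    using comaximal_cancel_iff[of a "q ^ e" "of_nat p ^ j * z"] comaximal_powers[of a q 1 e] assms
    by (simp add: mult.left_commute)
  then show ?thesis unfolding has_order_exponent_def by simp
qed

text \<open>
  The multiples of \<open>q ^ (e - j)\<close> modulo \<open>q ^ e\<close> are the elements of order dividing \<open>p ^ j\<close>; division
  by \<open>q ^ (e - j)\<close> identifies them with the classes modulo \<open>q ^ j\<close>.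
\<close>

lemma card_multiples:
  assumes "j \<le> e"
  shows "card (residue (q ^ e) ` {z \<in> gauss_int. q ^ (e - j) gdvd z}) = card (residues q) ^ j"
proof -
  define f where "f = (\<lambda>u. residue (q ^ e) (q ^ (e - j) * u))"
  have e: "q ^ e = q ^ (e - j) * q ^ j" using assms by (simp flip: power_add)
  have f: "f u = f u' \<longleftrightarrow> residue (q ^ j) u = residue (q ^ j) u'"
    if "u \<in> gauss_int" "u' \<in> gauss_int" for u u'
    using that unfolding f_def by (simp add: residue_eq_iff e flip: right_diff_distrib)
  have "{z \<in> gauss_int. q ^ (e - j) gdvd z} = (*) (q ^ (e - j)) ` gauss_int"
    by (auto simp: gdvd_def)
  then have "residue (q ^ e) ` {z \<in> gauss_int. q ^ (e - j) gdvd z} = f ` gauss_int"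
    by (simp add: f_def image_image)
  also have "card (f ` gauss_int) = card (residues (q ^ j))"
    unfolding residues_def by (rule image_same_fibers(1)) (rule f)
  finally show ?thesis by (simp add: card_residues_power)
qed

lemma card_has_order_exponent:
  assumes "h \<le> e"
  shows "card (residue (q ^ e) ` {z \<in> gauss_int. has_order_exponent (q ^ e) p h z})
           = card (residues q) ^ h - (if h = 0 then 0 else card (residues q) ^ (h - 1))"
proof (cases "h = 0")
  case True
  then show ?thesis
    using card_multiples[of 0 e] by (simp add: has_order_exponent_def)
next
  case False
  let ?M = "\<lambda>j. residue (q ^ e) ` {z \<in> gauss_int. q ^ (e - j) gdvd z}"
  have le: "h - 1 \<le> e" "h \<le> e" using assms by auto
  have ord: "has_order_exponent (q ^ e) p h z \<longleftrightarrow> q ^ (e - h) gdvd z \<and> \<not> q ^ (e - (h - 1)) gdvd z"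
    if "z \<in> gauss_int" for z
    using that le False by (simp add: has_order_exponent_def gdvd_p_power_iff)
  have inv: "q ^ (e - j) gdvd z'"
    if "residue (q ^ e) z = residue (q ^ e) z'" "z \<in> gauss_int" "z' \<in> gauss_int"
      "q ^ (e - j) gdvd z" for j z z'
  proof -
    have "q ^ (e - j) gdvd q ^ e" by (simp add: gdvd_power_le)
    also have "q ^ e gdvd z - z'" using that residue_eq_iff by blast
    finally have "q ^ (e - j) gdvd z - z'" .
    then have "q ^ (e - j) gdvd z - (z - z')" using that gdvd_diff by blast
    then show ?thesis by simp
  qed
  have "residue (q ^ e) ` {z \<in> gauss_int. has_order_exponent (q ^ e) p h z} = ?M h - ?M (h - 1)"
  proof (intro subset_antisym subsetI)
    fix X assume "X \<in> residue (q ^ e) ` {z \<in> gauss_int. has_order_exponent (q ^ e) p h z}"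
    then obtain z where z: "z \<in> gauss_int" "has_order_exponent (q ^ e) p h z" "X = residue (q ^ e) z"
      by auto
    then have "X \<in> ?M h" using ord by blast
    moreover have "X \<notin> ?M (h - 1)"
    proof
      assume "X \<in> ?M (h - 1)"
      then obtain z' where "z' \<in> gauss_int" "q ^ (e - (h - 1)) gdvd z'" "X = residue (q ^ e) z'"
        by auto
      then have "q ^ (e - (h - 1)) gdvd z" using z inv[of z' z] by simp
      then show False using z ord by blast
    qed
    ultimately show "X \<in> ?M h - ?M (h - 1)" by blast
  next
    fix X assume "X \<in> ?M h - ?M (h - 1)"
    then show "X \<in> residue (q ^ e) ` {z \<in> gauss_int. has_order_exponent (q ^ e) p h z}"
      using ord by blast
  qed
  moreover have "?M (h - 1) \<subseteq> ?M h"
  proof -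
    have "q ^ (e - h) gdvd q ^ (e - (h - 1))" using assms by (intro gdvd_power_le) auto
    then show ?thesis using gdvd_trans by blast
  qed
  moreover have "finite (?M h)"
    by (rule finite_subset[OF _ finite_residues[of "q ^ e"]]) (auto simp: residues_def)
  ultimately have "card (residue (q ^ e) ` {z \<in> gauss_int. has_order_exponent (q ^ e) p h z})
      = card (?M h) - card (?M (h - 1))"
    by (metis (no_types, lifting) card_Diff_subset finite_subset)
  then show ?thesis using False by (simp only: card_multiples[OF le(1)] card_multiples[OF le(2)] if_False)
qed

end

section \<open>Chinese remaindering and the part of a modulus prime to rho\<close>

text \<open>
  If \<open>x * a + y * b = 1\<close>, then \<open>t * (x * a) + s * (y * b)\<close> is congruent to \<open>s\<close> modulo \<open>a\<close> and to \<open>t\<close>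
  modulo \<open>b\<close>. Hence conditions on the two components are independent of each other.
\<close>

lemma card_residues_conj:
  assumes "comaximal a b" "a \<in> gauss_int" "b \<in> gauss_int"
    and P: "\<And>z z'. z \<in> gauss_int \<Longrightarrow> z' \<in> gauss_int \<Longrightarrow> a gdvd z - z' \<Longrightarrow> P z \<Longrightarrow> P z'"
    and Q: "\<And>z z'. z \<in> gauss_int \<Longrightarrow> z' \<in> gauss_int \<Longrightarrow> b gdvd z - z' \<Longrightarrow> Q z \<Longrightarrow> Q z'"
  shows "card (residue (a * b) ` {z \<in> gauss_int. P z \<and> Q z})
           = card (residue a ` {z \<in> gauss_int. P z}) * card (residue b ` {z \<in> gauss_int. Q z})"
proof -
  let ?f = "\<lambda>z. (residue a z, residue b z)"
  have "a * b gdvd z \<longleftrightarrow> a gdvd z \<and> b gdvd z" for z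
  proof
    assume "a * b gdvd z"
    moreover have "a gdvd a * b" "b gdvd a * b" using assms(2,3) by (simp_all add: gdvd_triv)
    ultimately show "a gdvd z \<and> b gdvd z" using gdvd_trans by blast
  next
    show "a gdvd z \<and> b gdvd z \<Longrightarrow> a * b gdvd z"
      using comaximal_mult_gdvd[OF assms(1)] assms(3) by simp
  qed
  then have "card (residue (a * b) ` {z \<in> gauss_int. P z \<and> Q z}) = card (?f ` {z \<in> gauss_int. P z \<and> Q z})"
    by (intro image_same_fibers(1)) (simp add: residue_eq_iff)
  also have "?f ` {z \<in> gauss_int. P z \<and> Q z}
      = (residue a ` {z \<in> gauss_int. P z}) \<times> (residue b ` {z \<in> gauss_int. Q z})"
  proof
    show "?f ` {z \<in> gauss_int. P z \<and> Q z}
      \<subseteq> (residue a ` {z \<in> gauss_int. P z}) \<times> (residue b ` {z \<in> gauss_int. Q z})" by auto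
    show "(residue a ` {z \<in> gauss_int. P z}) \<times> (residue b ` {z \<in> gauss_int. Q z})
      \<subseteq> ?f ` {z \<in> gauss_int. P z \<and> Q z}"
    proof clarify
      fix s t assume st: "s \<in> gauss_int" "P s" "t \<in> gauss_int" "Q t"
      obtain x y where g: "x \<in> gauss_int" "y \<in> gauss_int" and e: "x * a + y * b = 1"
        using assms(1) unfolding comaximal_def by auto
      define z where "z = t * (x * a) + s * (y * b)"
      have z: "z \<in> gauss_int" using g st assms(2,3) by (simp add: z_def)
      have "s - z = s * (x * a + y * b) - z" by (simp only: e mult_1_right)
      also have "\<dots> = (s - t) * x * a" by (simp add: z_def algebra_simps)
      finally have sz: "a gdvd s - z" using g st by (simp add: gdvd_triv)
      have "t - z = t * (x * a + y * b) - z" by (simp only: e mult_1_right)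
      also have "\<dots> = (t - s) * y * b" by (simp add: z_def algebra_simps)
      finally have tz: "b gdvd t - z" using g st by (simp add: gdvd_triv)
      have "P z" "Q z" using P[OF _ z sz] Q[OF _ z tz] st by auto
      moreover have "(residue a s, residue b t) = ?f z"
        using sz tz st z by (simp add: residue_eq_iff)
      ultimately show "(residue a s, residue b t) \<in> ?f ` {z \<in> gauss_int. P z \<and> Q z}"
        using z by blast
    qed
  qed
  finally show ?thesis by (simp add: card_cartesian_product)
qed

lemma card_residues_ball:
  assumes "finite I" "\<And>i. i \<in> I \<Longrightarrow> f i \<in> gauss_int"
    and "\<And>i j. i \<in> I \<Longrightarrow> j \<in> I \<Longrightarrow> i \<noteq> j \<Longrightarrow> comaximal (f i) (f j)"
    and "\<And>i z z'. i \<in> I \<Longrightarrow> z \<in> gauss_int \<Longrightarrow> z' \<in> gauss_int \<Longrightarrow> f i gdvd z - z' \<Longrightarrow> P i z \<Longrightarrow> P i z'"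
  shows "card (residue (\<Prod>i\<in>I. f i) ` {z \<in> gauss_int. \<forall>i\<in>I. P i z})
           = (\<Prod>i\<in>I. card (residue (f i) ` {z \<in> gauss_int. P i z}))"
  using assms
proof (induction I rule: finite_induct)
  case empty
  have "residue 1 ` gauss_int = {gauss_int}"
    using residues_unit unfolding residues_def .
  then show ?case by simp
next
  case (insert i I)
  have prod: "(\<Prod>j\<in>I. f j) \<in> gauss_int" using insert.prems by (intro gauss_int_prod) auto
  have "card (residue (f i * (\<Prod>j\<in>I. f j)) ` {z \<in> gauss_int. P i z \<and> (\<forall>j\<in>I. P j z)})
      = card (residue (f i) ` {z \<in> gauss_int. P i z})
        * card (residue (\<Prod>j\<in>I. f j) ` {z \<in> gauss_int. \<forall>j\<in>I. P j z})"
  proof (rule card_residues_conj)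
    show "comaximal (f i) (\<Prod>j\<in>I. f j)"
      using insert.hyps insert.prems(1,2) by (intro comaximal_sym[OF comaximal_prod]) auto
    show "\<forall>j\<in>I. P j z'"
      if "z \<in> gauss_int" "z' \<in> gauss_int" "(\<Prod>j\<in>I. f j) gdvd z - z'" "\<forall>j\<in>I. P j z" for z z'
    proof
      fix j assume j: "j \<in> I"
      have "\<forall>j\<in>I. f j gdvd z - z'"
        using that(1-3) insert.hyps(1) insert.prems(1,2)
        by (subst prod_gdvd_iff[symmetric]) auto
      then show "P j z'" using j that(1,2,4) insert.prems(3)[of j z z'] by simp
    qed
    show "P i z'" if "z \<in> gauss_int" "z' \<in> gauss_int" "f i gdvd z - z'" "P i z" for z z'
      using that insert.prems(3)[of i z z'] by simp
  qed (use prod insert.prems(1) in auto)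
  also have "card (residue (\<Prod>j\<in>I. f j) ` {z \<in> gauss_int. \<forall>j\<in>I. P j z})
      = (\<Prod>j\<in>I. card (residue (f j) ` {z \<in> gauss_int. P j z}))"
    by (rule insert.IH) (blast intro: insert.prems)+
  finally show ?case using insert.hyps by simp
qed

text \<open>
  The modulus of the sequel is a power of \<open>rho\<close> times powers of pairwise comaximal primes \<open>q i\<close> as
  above; \<open>e 0\<close> is the exponent of \<open>rho\<close>.
\<close>

locale factored_modulus =
  fixes w :: nat and p e :: "nat \<Rightarrow> nat" and q c :: "nat \<Rightarrow> complex"
  assumes factor: "\<And>i. i \<in> {1..w} \<Longrightarrow> odd_prime_factor (p i) (q i) (c i)"
    and distinct: "\<And>i j. i \<in> {1..w} \<Longrightarrow> j \<in> {1..w} \<Longrightarrow> i \<noteq> j \<Longrightarrow> comaximal (q i) (q j)"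
begin

definition modulus :: complex where
  "modulus = rho ^ e 0 * (\<Prod>i\<in>{1..w}. q i ^ e i)"

definition exact_orders :: "(nat \<Rightarrow> nat) \<Rightarrow> complex \<Rightarrow> bool" where
  "exact_orders h z \<longleftrightarrow> rho ^ e 0 gdvd z \<and> (\<forall>i\<in>{1..w}. has_order_exponent (q i ^ e i) (p i) (h i) z)"

lemma rho_gauss_int [simp]: "rho \<in> gauss_int"
  by auto

lemma q_gauss_int [simp]: "i \<in> {1..w} \<Longrightarrow> q i \<in> gauss_int"
  using factor odd_prime_factor.q by blast

lemma comaximal_rho_q: "i \<in> {1..w} \<Longrightarrow> comaximal rho (q i)"
  using factor odd_prime_factor.comaximal_rho by blast

lemma odd_part_gauss_int: "(\<Prod>i\<in>{1..w}. q i ^ e i) \<in> gauss_int"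
  by (intro gauss_int_prod gauss_int_power q_gauss_int)

lemma odd_part_gdvd_iff:
  assumes "z \<in> gauss_int"
  shows "(\<Prod>i\<in>{1..w}. q i ^ e i) gdvd z \<longleftrightarrow> (\<forall>i\<in>{1..w}. q i ^ e i gdvd z)"
  using assms distinct by (intro prod_gdvd_iff comaximal_powers) auto

lemma comaximal_rho_odd_part: "comaximal (rho ^ k) (\<Prod>i\<in>{1..w}. q i ^ e i)"
proof -
  have "comaximal (\<Prod>i\<in>{1..w}. q i ^ e i) (rho ^ k)"
  proof (rule comaximal_prod)
    fix i assume "i \<in> {1..w}"
    then show "comaximal (q i ^ e i) (rho ^ k)" "q i ^ e i \<in> gauss_int"
      using comaximal_rho_q comaximal_sym by (auto intro!: comaximal_powers simp del: atLeastAtMost_iff)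
  qed simp
  then show ?thesis by (rule comaximal_sym)
qed

lemma modulus_gdvd_iff:
  assumes "z \<in> gauss_int"
  shows "modulus gdvd z \<longleftrightarrow> rho ^ e 0 gdvd z \<and> (\<forall>i\<in>{1..w}. q i ^ e i gdvd z)"
proof -
  have "rho ^ e 0 gdvd modulus" "(\<Prod>i\<in>{1..w}. q i ^ e i) gdvd modulus"
    unfolding modulus_def by (intro gdvd_triv odd_part_gauss_int gauss_int_power rho_gauss_int)+
  then have "modulus gdvd z \<longleftrightarrow> rho ^ e 0 gdvd z \<and> (\<Prod>i\<in>{1..w}. q i ^ e i) gdvd z"
    using comaximal_mult_gdvd[OF comaximal_rho_odd_part _ _ odd_part_gauss_int] gdvd_trans
    unfolding modulus_def by blast
  then show ?thesis using odd_part_gdvd_iff[OF assms] by simp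
qed

lemma exact_orders_annihilator:
  assumes "exact_orders h z" "z \<in> gauss_int" "a \<in> gauss_int"
  shows "modulus gdvd a * z \<longleftrightarrow> (\<forall>i\<in>{1..w}. q i ^ h i gdvd a)"
proof -
  have "q i ^ e i gdvd a * z \<longleftrightarrow> q i ^ h i gdvd a" if "i \<in> {1..w}" for i
    using odd_prime_factor.annihilator_iff[OF factor[OF that]] assms that
    unfolding exact_orders_def by blast
  moreover have "rho ^ e 0 gdvd a * z"
    using assms gdvd_mult unfolding exact_orders_def by blast
  ultimately show ?thesis using assms modulus_gdvd_iff by simp
qed

lemma exact_orders_exist:
  assumes "rho ^ e 0 gdvd z" "z \<in> gauss_int"
  obtains h where "h \<in> H_set w e" "exact_orders h z"
proof -
  have "\<forall>i\<in>{1..w}. \<exists>k\<le>e i. has_order_exponent (q i ^ e i) (p i) k z"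
    using odd_prime_factor.has_order_exponent_exists[OF factor] assms by blast
  then obtain h where h: "\<forall>i\<in>{1..w}. h i \<le> e i \<and> has_order_exponent (q i ^ e i) (p i) (h i) z"
    by metis
  show ?thesis
  proof (rule that)
    show "restrict h {1..w} \<in> H_set w e" using h unfolding H_set_def by auto
    show "exact_orders (restrict h {1..w}) z" using h assms unfolding exact_orders_def by auto
  qed
qed

lemma exact_orders_mult:
  assumes "exact_orders h z" "z \<in> gauss_int" "a \<in> gauss_int" "\<And>i. i \<in> {1..w} \<Longrightarrow> comaximal a (q i)"
  shows "exact_orders h (a * z)"
  unfolding exact_orders_def
proof (intro conjI ballI)
  show "rho ^ e 0 gdvd a * z" using assms gdvd_mult unfolding exact_orders_def by blast
  fix i assume i: "i \<in> {1..w}"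
  show "has_order_exponent (q i ^ e i) (p i) (h i) (a * z)"
    using odd_prime_factor.has_order_exponent_mult_iff[OF factor[OF i]] assms i
    unfolding exact_orders_def by blast
qed

lemma exact_orders_rho_power: "exact_orders h z \<Longrightarrow> z \<in> gauss_int \<Longrightarrow> exact_orders h (rho ^ k * z)"
  by (intro exact_orders_mult comaximal_power comaximal_rho_q gauss_int_power rho_gauss_int q_gauss_int)

lemma exact_orders_uminus: "exact_orders h z \<Longrightarrow> z \<in> gauss_int \<Longrightarrow> exact_orders h (- z)"
proof -
  assume "exact_orders h z" "z \<in> gauss_int"
  moreover have "comaximal (- 1) d" for d
    unfolding comaximal_def by (rule bexI[of _ "- 1"], rule bexI[of _ 0]) auto
  ultimately show ?thesis using exact_orders_mult[of h z "- 1"] by simp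
qed

lemma card_exact_orders:
  assumes "h \<in> H_set w e"
  shows "card (residue modulus ` {z \<in> gauss_int. exact_orders h z})
           = (\<Prod>i\<in>{1..w}. card (residues (q i)) ^ h i
                             - (if h i = 0 then 0 else card (residues (q i)) ^ (h i - 1)))"
proof -
  let ?P = "\<lambda>i. has_order_exponent (q i ^ e i) (p i) (h i)"
  have "card (residue modulus ` {z \<in> gauss_int. exact_orders h z})
      = card (residue (rho ^ e 0) ` {z \<in> gauss_int. rho ^ e 0 gdvd z})
        * card (residue (\<Prod>i\<in>{1..w}. q i ^ e i) ` {z \<in> gauss_int. \<forall>i\<in>{1..w}. ?P i z})"
    unfolding modulus_def exact_orders_def
  proof (rule card_residues_conj)
    show "rho ^ e 0 gdvd z'" if "rho ^ e 0 gdvd z - z'" "rho ^ e 0 gdvd z" for z z'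
      using gdvd_diff[OF that(2) that(1)] by simp
    show "\<forall>i\<in>{1..w}. ?P i z'"
      if "z \<in> gauss_int" "z' \<in> gauss_int" "(\<Prod>i\<in>{1..w}. q i ^ e i) gdvd z - z'"
        "\<forall>i\<in>{1..w}. ?P i z" for z z'
      using that odd_part_gdvd_iff[of "z - z'"] has_order_exponent_cong by fast
  qed (rule comaximal_rho_odd_part odd_part_gauss_int gauss_int_power rho_gauss_int)+
  also have "residue (rho ^ e 0) ` {z \<in> gauss_int. rho ^ e 0 gdvd z} = {residue (rho ^ e 0) 0}"
  proof
    show "residue (rho ^ e 0) ` {z \<in> gauss_int. rho ^ e 0 gdvd z} \<subseteq> {residue (rho ^ e 0) 0}"
      using residue_eq_iff[where z' = 0] by auto
    have "0 \<in> {z \<in> gauss_int. rho ^ e 0 gdvd z}" by simp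
    then show "{residue (rho ^ e 0) 0} \<subseteq> residue (rho ^ e 0) ` {z \<in> gauss_int. rho ^ e 0 gdvd z}"
      by blast
  qed
  also have "card (residue (\<Prod>i\<in>{1..w}. q i ^ e i) ` {z \<in> gauss_int. \<forall>i\<in>{1..w}. ?P i z})
      = (\<Prod>i\<in>{1..w}. card (residue (q i ^ e i) ` {z \<in> gauss_int. ?P i z}))"
    using has_order_exponent_cong
    by (intro card_residues_ball comaximal_powers distinct) (auto simp del: atLeastAtMost_iff)
  also have "\<dots> = (\<Prod>i\<in>{1..w}. card (residues (q i)) ^ h i
                             - (if h i = 0 then 0 else card (residues (q i)) ^ (h i - 1)))"
  proof (rule prod.cong)
    fix i assume i: "i \<in> {1..w}"
    then have "h i \<le> e i" using assms unfolding H_set_def by auto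
    then show "card (residue (q i ^ e i) ` {z \<in> gauss_int. ?P i z})
        = card (residues (q i)) ^ h i - (if h i = 0 then 0 else card (residues (q i)) ^ (h i - 1))"
      by (rule odd_prime_factor.card_has_order_exponent[OF factor[OF i]])
  qed simp
  finally show ?thesis by simp
qed

text \<open>
  \<open>rho\<close> is a unit of the finite ring of classes modulo the part of the modulus prime to \<open>rho\<close>, so
  two of its powers agree there and their quotient is 1.
\<close>

lemma ex_rho_power_cong_1: "\<exists>k\<ge>1. \<forall>i\<in>{1..w}. q i ^ e i gdvd rho ^ k - 1"
proof -
  let ?D = "\<Prod>i\<in>{1..w}. q i ^ e i"
  have "?D \<noteq> 0" using odd_prime_factor.q_nonzero[OF factor] by (simp del: atLeastAtMost_iff)
  then have "finite (residues ?D)" by (intro finite_residues odd_part_gauss_int)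
  moreover have "range (\<lambda>k::nat. residue ?D (rho ^ k)) \<subseteq> residues ?D"
    unfolding residues_def by (blast intro: gauss_int_power rho_gauss_int)
  ultimately have "finite (range (\<lambda>k::nat. residue ?D (rho ^ k)))" using finite_subset by blast
  then have "\<not> inj (\<lambda>k::nat. residue ?D (rho ^ k))" using finite_imageD infinite_UNIV_nat by blast
  then obtain j k where "j \<noteq> k" "residue ?D (rho ^ j) = residue ?D (rho ^ k)"
    unfolding inj_def by blast
  then obtain j k where jk: "j < k" "residue ?D (rho ^ k) = residue ?D (rho ^ j)"
    by (cases "j < k") (metis linorder_neqE_nat)+
  then have "?D gdvd rho ^ k - rho ^ j" by (subst (asm) residue_eq_iff) auto
  moreover have "rho ^ k = rho ^ j * rho ^ (k - j)" using jk by (simp flip: power_add)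
  ultimately have "?D gdvd rho ^ j * (rho ^ (k - j) - 1)"
    by (simp only: right_diff_distrib mult_1_right)
  then have "?D gdvd rho ^ (k - j) - 1"
    by (rule comaximal_cancel[OF comaximal_rho_odd_part]) (intro gauss_int_closed gauss_int_power)
  then have "\<forall>i\<in>{1..w}. q i ^ e i gdvd rho ^ (k - j) - 1"
    by (subst (asm) odd_part_gdvd_iff) auto
  then show ?thesis using jk by (intro exI[of _ "k - j"]) auto
qed

text \<open>
  \<open>rho ^ k - s\<close> is congruent to \<open>- s\<close> modulo \<open>rho\<close>, hence a unit modulo every power of \<open>rho\<close>: a
  periodic element has no component at \<open>rho\<close>.
\<close>

lemma rho_power_gdvd_cancel:
  assumes "k \<ge> 1" "rho ^ l gdvd (rho ^ k - s) * z" "s = 1 \<or> s = - 1" "z \<in> gauss_int"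
  shows "rho ^ l gdvd z"
proof -
  have s: "s \<in> gauss_int" "s * s = 1" using assms by auto
  have "rho ^ k = rho ^ (k - 1) * rho"
    using assms(1) by (intro power_minus_mult[symmetric]) simp
  then have "(s * rho ^ (k - 1)) * rho + (- s) * (rho ^ k - s) = s * s"
    by (simp only: algebra_simps) simp
  then have "(s * rho ^ (k - 1)) * rho + (- s) * (rho ^ k - s) = 1" by (simp only: s)
  moreover have "s * rho ^ (k - 1) \<in> gauss_int" "- s \<in> gauss_int"
    by (intro gauss_int_closed gauss_int_power rho_gauss_int s)+
  ultimately have "comaximal rho (rho ^ k - s)" unfolding comaximal_def by blast
  then have "comaximal (rho ^ l) (rho ^ k - s)"
    using s by (intro comaximal_power) auto
  then show ?thesis using assms comaximal_cancel comaximal_sym by blast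
qed

end

section \<open>Cycles of theta\<close>

lemma period_least:
  assumes "periodic g"
  shows "period g \<ge> 1" "(theta ^^ period g) g = g"
    and "\<And>k. k \<ge> 1 \<Longrightarrow> (theta ^^ k) g = g \<Longrightarrow> period g \<le> k"
proof -
  have "period g \<ge> 1 \<and> (theta ^^ period g) g = g"
    unfolding period_def by (rule LeastI_ex) (use assms periodic_def in blast)
  then show "period g \<ge> 1" "(theta ^^ period g) g = g" by auto
  show "period g \<le> k" if "k \<ge> 1" "(theta ^^ k) g = g" for k
    unfolding period_def by (rule Least_le) (use that in blast)
qed

text \<open>
  The unbounded orbit coincides with the cycle when \<open>g\<close> is periodic, and is easier to compare for
  two points.
\<close>

definition orbit :: "'a::field proj_line \<Rightarrow> 'a proj_line set" where
  "orbit g = range (\<lambda>i. (theta ^^ i) g)"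

lemma orbit_eq:
  assumes "periodic g"
  shows "{(theta ^^ i) g | i. i < period g} = orbit g"
proof
  show "orbit g \<subseteq> {(theta ^^ i) g | i. i < period g}"
  proof
    fix x assume "x \<in> orbit g"
    then obtain i where "x = (theta ^^ i) g" unfolding orbit_def by auto
    then have "x = (theta ^^ (i mod period g)) g"
      using funpow_mod_eq[OF period_least(2)[OF assms]] by metis
    moreover have "i mod period g < period g" using period_least(1)[OF assms] by simp
    ultimately show "x \<in> {(theta ^^ i) g | i. i < period g}" by blast
  qed
qed (auto simp: orbit_def)

lemma cycle_of_length_iff:
  "cycle_of_length l c \<longleftrightarrow> (\<exists>g. periodic g \<and> l = period g \<and> c = orbit g)"
proof
  assume "cycle_of_length l c"
  then show "\<exists>g. periodic g \<and> l = period g \<and> c = orbit g"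
    unfolding cycle_of_length_def using orbit_eq by blast
next
  assume "\<exists>g. periodic g \<and> l = period g \<and> c = orbit g"
  then obtain g where "periodic g" "l = period g" "c = orbit g" by blast
  then show "cycle_of_length l c"
    unfolding cycle_of_length_def by (intro exI[of _ g]) (simp add: orbit_eq)
qed

lemma cycles_in_eq: "cycles_in S = {orbit g | g. periodic g \<and> orbit g \<subseteq> S}"
  unfolding cycles_in_def cycle_of_length_iff by blast

lemma self_in_orbit: "g \<in> orbit g"
  unfolding orbit_def by (rule image_eqI[of _ _ 0]) auto

lemma orbit_eq_of_mem:
  assumes "periodic g" "x \<in> orbit g"
  shows "orbit x = orbit g"
proof -
  have sub: "orbit (y::'a::field proj_line) \<subseteq> orbit z" if yz: "y \<in> orbit z" for y z
  proof -
    obtain i where "y = (theta ^^ i) z" using yz unfolding orbit_def by auto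
    then have "(theta ^^ j) y = (theta ^^ (j + i)) z" for j by (simp add: funpow_add)
    then show ?thesis unfolding orbit_def by auto
  qed
  obtain i where i: "i < period g" "x = (theta ^^ i) g"
    using assms orbit_eq by blast
  then have "(theta ^^ (period g - i)) x = (theta ^^ (period g - i + i)) g"
    by (simp only: funpow_add o_apply)
  then have "(theta ^^ (period g - i)) x = g" using i period_least(2)[OF assms(1)] by simp
  then have "g \<in> orbit x" unfolding orbit_def by (metis rangeI)
  then show ?thesis using sub assms by blast
qed

lemma card_orbit:
  assumes "periodic g"
  shows "card (orbit g) = period g"
proof -
  have "inj_on (\<lambda>i. (theta ^^ i) g) {..<period g}"
  proof (rule linorder_inj_onI)
    fix i j assume ij: "i < j" "i \<in> {..<period g}" "j \<in> {..<period g}"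
    show "(theta ^^ i) g \<noteq> (theta ^^ j) g"
    proof
      assume "(theta ^^ i) g = (theta ^^ j) g"
      then have "(theta ^^ (period g - j + i)) g = (theta ^^ (period g - j + j)) g"
        by (simp only: funpow_add o_apply)
      also have "\<dots> = g" using ij period_least(2)[OF assms] by simp
      finally have "period g \<le> period g - j + i"
        using ij by (intro period_least(3)[OF assms]) auto
      then show False using ij by auto
    qed
  qed auto
  then have "card ((\<lambda>i. (theta ^^ i) g) ` {..<period g}) = period g"
    by (simp add: card_image)
  moreover have "(\<lambda>i. (theta ^^ i) g) ` {..<period g} = orbit g"
    using orbit_eq[OF assms] by auto
  ultimately show ?thesis by simp
qed

text \<open>
  The cycles inside an invariant set of periodic points partition it.
\<close>

lemma card_cycles_in:
  assumes "finite S" "theta ` S \<subseteq> S" "\<And>x. x \<in> S \<Longrightarrow> periodic x \<and> period x = l"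
  shows "l * card (cycles_in S) = card S" and "\<And>c. c \<in> cycles_in S \<Longrightarrow> cycle_of_length l c"
proof -
  have "(theta ^^ i) x \<in> S" if "x \<in> S" for i x
    using that assms(2) by (induction i) auto
  then have sub: "orbit x \<subseteq> S" if "x \<in> S" for x
    using that unfolding orbit_def by auto
  have cyc: "cycles_in S = orbit ` S"
    unfolding cycles_in_eq using sub self_in_orbit assms(3) by blast
  have un: "\<Union>(cycles_in S) = S"
    unfolding cyc using sub self_in_orbit by blast
  have "l * card (cycles_in S) = card (\<Union>(cycles_in S))"
  proof (rule card_partition)
    show "finite (cycles_in S)" unfolding cyc using assms(1) by simp
    show "finite (\<Union>(cycles_in S))" using un assms(1) by simp
    show "card c = l" if "c \<in> cycles_in S" for c
      using that card_orbit assms(3) unfolding cyc by auto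
    fix c c' assume "c \<in> cycles_in S" "c' \<in> cycles_in S" "c \<noteq> c'"
    then obtain g g' where gg: "g \<in> S" "g' \<in> S" "c = orbit g" "c' = orbit g'" unfolding cyc by blast
    have "orbit g = orbit g'" if "x \<in> orbit g" "x \<in> orbit g'" for x
      using that gg orbit_eq_of_mem assms(3) by metis
    then show "c \<inter> c' = {}" using gg \<open>c \<noteq> c'\<close> by blast
  qed
  then show "l * card (cycles_in S) = card S" by (simp only: un)
  show "cycle_of_length l c" if "c \<in> cycles_in S" for c
    using that assms(3) unfolding cyc cycle_of_length_iff by blast
qed

section \<open>Multiplication by rho up to sign\<close>

text \<open>
  \<open>\<chi>\<close> identifies the Gaussian integers modulo \<open>modulus\<close> and up to sign with points of the
  projective line, in such a way that multiplication by \<open>rho\<close> becomes \<open>theta\<close>. The set \<open>X\<close> may omit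
  points, as the abscissas of the quadratic twist do, but only points killed by a power of \<open>rho\<close>.
\<close>

locale signed_rho_dynamics = factored_modulus +
  fixes \<chi> :: "complex \<Rightarrow> 'a::field proj_line" and X :: "'a proj_line set"
  assumes \<chi>_eq_iff: "\<And>z z'. z \<in> gauss_int \<Longrightarrow> z' \<in> gauss_int \<Longrightarrow>
      \<chi> z = \<chi> z' \<longleftrightarrow> modulus gdvd z - z' \<or> modulus gdvd z + z'"
    and theta_\<chi>: "\<And>z. z \<in> gauss_int \<Longrightarrow> theta (\<chi> z) = \<chi> (rho * z)"
    and X_subset: "X \<subseteq> \<chi> ` gauss_int"
    and outside_X: "\<And>z. z \<in> gauss_int \<Longrightarrow> \<chi> z \<notin> X \<Longrightarrow> \<exists>k. modulus gdvd rho ^ k * z"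
begin

definition stratum :: "(nat \<Rightarrow> nat) \<Rightarrow> 'a proj_line set" where
  "stratum h = {x \<in> X. \<exists>z\<in>gauss_int. \<chi> z = x \<and> exact_orders h z}"

text \<open>
  The numbers \<open>k\<close> of steps after which \<open>theta\<close> is the identity on the points with orders \<open>h\<close>. The
  second alternative comes from the identification of opposite points. Only \<open>h\<close> enters, not a point.
\<close>

definition returns :: "(nat \<Rightarrow> nat) \<Rightarrow> nat \<Rightarrow> bool" where
  "returns h k \<longleftrightarrow> k \<ge> 1 \<and>
     ((\<forall>i\<in>{1..w}. q i ^ h i gdvd rho ^ k - 1) \<or> (\<forall>i\<in>{1..w}. q i ^ h i gdvd rho ^ k + 1))"

lemma theta_power_\<chi>: "z \<in> gauss_int \<Longrightarrow> (theta ^^ k) (\<chi> z) = \<chi> (rho ^ k * z)"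
proof (induction k)
  case (Suc k)
  have "rho ^ k * z \<in> gauss_int" by (intro gauss_int_closed gauss_int_power rho_gauss_int Suc.prems)
  then have "theta (\<chi> (rho ^ k * z)) = \<chi> (rho * (rho ^ k * z))" by (rule theta_\<chi>)
  then show ?case using Suc by (simp only: funpow.simps o_apply power_Suc mult.assoc)
qed simp

lemma theta_power_fixes_iff:
  assumes "z \<in> gauss_int"
  shows "(theta ^^ k) (\<chi> z) = \<chi> z \<longleftrightarrow> modulus gdvd (rho ^ k - 1) * z \<or> modulus gdvd (rho ^ k + 1) * z"
proof -
  have "rho ^ k * z \<in> gauss_int" by (intro gauss_int_closed gauss_int_power rho_gauss_int assms)
  moreover have "rho ^ k * z - z = (rho ^ k - 1) * z" "rho ^ k * z + z = (rho ^ k + 1) * z"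
    by (simp_all only: left_diff_distrib distrib_right mult_1_left)
  ultimately show ?thesis using \<chi>_eq_iff[of "rho ^ k * z" z] theta_power_\<chi> assms by simp
qed

lemma returns_iff:
  assumes "exact_orders h z" "z \<in> gauss_int"
  shows "returns h k \<longleftrightarrow> k \<ge> 1 \<and> (theta ^^ k) (\<chi> z) = \<chi> z"
proof -
  have "rho ^ k - 1 \<in> gauss_int" "rho ^ k + 1 \<in> gauss_int"
    by (intro gauss_int_closed gauss_int_power rho_gauss_int)+
  then show ?thesis
    unfolding returns_def theta_power_fixes_iff[OF assms(2)]
    using exact_orders_annihilator[OF assms] by simp
qed

text \<open>
  Returning up to sign means that \<open>rho ^ k - 1\<close> or \<open>rho ^ k + 1\<close> kills \<open>z\<close>. Both are units at \<open>rho\<close>,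
  which forces the component at \<open>rho\<close> to vanish; conversely \<open>rho\<close> acts on the remaining components
  with finite order.
\<close>

lemma periodic_iff:
  assumes "z \<in> gauss_int"
  shows "periodic (\<chi> z) \<longleftrightarrow> rho ^ e 0 gdvd z"
proof
  assume "periodic (\<chi> z)"
  then obtain k where k: "k \<ge> 1" "(theta ^^ k) (\<chi> z) = \<chi> z" unfolding periodic_def by blast
  then obtain s where s: "s = 1 \<or> s = - 1" "modulus gdvd (rho ^ k - s) * z"
    using theta_power_fixes_iff[OF assms] by (metis diff_minus_eq_add)
  have "s \<in> gauss_int" using s by auto
  then have "(rho ^ k - s) * z \<in> gauss_int"
    by (intro gauss_int_closed gauss_int_power rho_gauss_int assms)
  then have "rho ^ e 0 gdvd (rho ^ k - s) * z" using s modulus_gdvd_iff by blast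
  then show "rho ^ e 0 gdvd z" using k s assms rho_power_gdvd_cancel by blast
next
  assume z: "rho ^ e 0 gdvd z"
  obtain k where k: "k \<ge> 1" "\<forall>i\<in>{1..w}. q i ^ e i gdvd rho ^ k - 1"
    using ex_rho_power_cong_1 by blast
  have g: "rho ^ k - 1 \<in> gauss_int" by (intro gauss_int_closed gauss_int_power rho_gauss_int)
  have "modulus gdvd (rho ^ k - 1) * z"
    unfolding modulus_gdvd_iff[OF gauss_int_closed(9)[OF g assms]]
    using z k gdvd_mult[OF z g] gdvd_mult_right[OF _ assms] by blast
  then show "periodic (\<chi> z)"
    unfolding periodic_def theta_power_fixes_iff[OF assms] using k by blast
qed

lemma orbit_\<chi>: "z \<in> gauss_int \<Longrightarrow> orbit (\<chi> z) = range (\<lambda>k. \<chi> (rho ^ k * z))"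
  unfolding orbit_def using theta_power_\<chi> by simp

lemma rho_power_mult_gauss_int: "z \<in> gauss_int \<Longrightarrow> rho ^ k * z \<in> gauss_int"
  by (intro gauss_int_closed gauss_int_power rho_gauss_int)

lemma cycles_in_X: "cycles_in X = (\<Union>h\<in>H_set w e. cycles_in (stratum h))"
proof
  show "(\<Union>h\<in>H_set w e. cycles_in (stratum h)) \<subseteq> cycles_in X"
    unfolding cycles_in_def stratum_def by blast
  show "cycles_in X \<subseteq> (\<Union>h\<in>H_set w e. cycles_in (stratum h))"
  proof
    fix c assume "c \<in> cycles_in X"
    then obtain g where g: "periodic g" "orbit g \<subseteq> X" "c = orbit g" unfolding cycles_in_eq by blast
    then obtain z where z: "z \<in> gauss_int" "g = \<chi> z" using X_subset self_in_orbit by blast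
    then have "rho ^ e 0 gdvd z" using g periodic_iff by blast
    then obtain h where h: "h \<in> H_set w e" "exact_orders h z" using z exact_orders_exist by blast
    have "orbit g \<subseteq> stratum h"
    proof
      fix x assume x: "x \<in> orbit g"
      then obtain k where "x = \<chi> (rho ^ k * z)" using orbit_\<chi> z by auto
      then show "x \<in> stratum h"
        using x g(2) rho_power_mult_gauss_int[OF z(1)] exact_orders_rho_power[OF h(2) z(1)]
        unfolding stratum_def by blast
    qed
    then show "c \<in> (\<Union>h\<in>H_set w e. cycles_in (stratum h))"
      using g h unfolding cycles_in_eq by blast
  qed
qed

text \<open>
  Applied to powers of \<open>rho\<close>, this shows that the points missing from \<open>X\<close> do not have orders \<open>h\<close>;
  applied to 2, that no point with orders \<open>h\<close> is its own opposite.
\<close>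

lemma exact_orders_not_killed:
  assumes "exact_orders h z" "z \<in> gauss_int" "i \<in> {1..w}" "h i \<noteq> 0"
    and "a \<in> gauss_int" "\<And>i. i \<in> {1..w} \<Longrightarrow> comaximal a (q i)"
  shows "\<not> modulus gdvd a * z"
proof
  assume "modulus gdvd a * z"
  then have "q i ^ h i gdvd a * 1" using exact_orders_annihilator assms(1-3,5) by simp
  moreover have "comaximal a (q i ^ h i)"
    using comaximal_powers[of a "q i" 1 "h i"] assms by simp
  ultimately have "q i ^ h i gdvd 1" using comaximal_cancel by blast
  moreover have "q i gdvd q i ^ h i"
    using assms gdvd_power_le[of "q i" 1 "h i"] by simp
  ultimately have "q i gdvd 1" using gdvd_trans by blast
  then show False using odd_prime_factor.not_unit[OF factor[OF assms(3)]] by blast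
qed

lemma stratum_eq:
  assumes "\<exists>i\<in>{1..w}. h i \<noteq> 0"
  shows "stratum h = \<chi> ` {z \<in> gauss_int. exact_orders h z}"
proof -
  have "\<chi> z \<in> X" if z: "z \<in> gauss_int" "exact_orders h z" for z
  proof (rule ccontr)
    assume "\<chi> z \<notin> X"
    then obtain k where k: "modulus gdvd rho ^ k * z" using outside_X z by blast
    obtain i where i: "i \<in> {1..w}" "h i \<noteq> 0" using assms by blast
    have "\<not> modulus gdvd rho ^ k * z"
      by (rule exact_orders_not_killed[OF z(2,1) i])
        (intro gauss_int_power rho_gauss_int comaximal_power comaximal_rho_q q_gauss_int; assumption)+
    then show False using k by blast
  qed
  then show ?thesis unfolding stratum_def by blast
qed

text \<open>
  A class of odd order greater than 1 differs from its opposite, and these two classes are the fiber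
  of \<open>\<chi>\<close> through either of them.
\<close>

lemma card_stratum:
  assumes "\<exists>i\<in>{1..w}. h i \<noteq> 0"
  shows "2 * card (stratum h) = card (residue modulus ` {z \<in> gauss_int. exact_orders h z})"
    and "finite (stratum h)"
proof -
  let ?Z = "{z \<in> gauss_int. exact_orders h z}"
  let ?pair = "\<lambda>z. {residue modulus z, residue modulus (- z)}"
  have res: "residue modulus z = residue modulus z' \<longleftrightarrow> modulus gdvd z - z'"
    "residue modulus (- z) = residue modulus (- z') \<longleftrightarrow> modulus gdvd z - z'"
    "residue modulus z = residue modulus (- z') \<longleftrightarrow> modulus gdvd z + z'"
    "residue modulus (- z) = residue modulus z' \<longleftrightarrow> modulus gdvd z + z'"
    if "z \<in> ?Z" "z' \<in> ?Z" for z z'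
  proof -
    have "- z - (- z') = - (z - z')" "- z - z' = - (z + z')" by simp_all
    then have "modulus gdvd - z - (- z') \<longleftrightarrow> modulus gdvd z - z'"
      "modulus gdvd - z - z' \<longleftrightarrow> modulus gdvd z + z'"
      by (simp_all only: gdvd_minus_iff)
    moreover have "z \<in> gauss_int" "z' \<in> gauss_int" "- z \<in> gauss_int" "- z' \<in> gauss_int"
      using that by auto
    ultimately show "residue modulus z = residue modulus z' \<longleftrightarrow> modulus gdvd z - z'"
      "residue modulus (- z) = residue modulus (- z') \<longleftrightarrow> modulus gdvd z - z'"
      "residue modulus z = residue modulus (- z') \<longleftrightarrow> modulus gdvd z + z'"
      "residue modulus (- z) = residue modulus z' \<longleftrightarrow> modulus gdvd z + z'"
      by (simp_all only: residue_eq_iff diff_minus_eq_add)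
  qed
  have \<chi>: "\<chi> z = \<chi> z' \<longleftrightarrow> ?pair z = ?pair z'" if "z \<in> ?Z" "z' \<in> ?Z" for z z'
  proof -
    have "?pair z = ?pair z' \<longleftrightarrow> modulus gdvd z - z' \<or> modulus gdvd z + z'"
      unfolding doubleton_eq_iff res[OF that] by blast
    then show ?thesis using that \<chi>_eq_iff[of z z'] by simp
  qed
  have fin: "finite (residue modulus ` ?Z)"
  proof (rule finite_subset[OF _ finite_residues])
    show "residue modulus ` ?Z \<subseteq> residues modulus" unfolding residues_def by blast
    show "modulus \<in> gauss_int"
      unfolding modulus_def by (intro gauss_int_closed odd_part_gauss_int gauss_int_power rho_gauss_int)
    have "(\<Prod>i\<in>{1..w}. q i ^ e i) \<noteq> 0"
      using odd_prime_factor.q_nonzero[OF factor] by (simp del: atLeastAtMost_iff)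
    moreover have "rho \<noteq> 0" by (simp add: complex_eq_iff)
    ultimately show "modulus \<noteq> 0"
      unfolding modulus_def by (simp only: no_zero_divisors power_not_zero not_False_eq_True)
  qed
  have neg: "- z \<in> ?Z" if "z \<in> ?Z" for z using that exact_orders_uminus by auto
  have un: "\<Union> (?pair ` ?Z) = residue modulus ` ?Z" using neg by blast
  have card_pair: "card (?pair ` ?Z) = card (\<chi> ` ?Z)"
    by (rule image_same_fibers(1)[symmetric]) (rule \<chi>)
  have "2 * card (?pair ` ?Z) = card (\<Union> (?pair ` ?Z))"
  proof (rule card_partition)
    show "finite (\<Union> (?pair ` ?Z))" unfolding un by (rule fin)
    then show "finite (?pair ` ?Z)" by (rule finite_UnionD)
    show "card P = 2" if P: "P \<in> ?pair ` ?Z" for P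
    proof -
      obtain z where z: "z \<in> ?Z" "P = ?pair z" using P by (rule imageE)
      obtain i where "i \<in> {1..w}" "h i \<noteq> 0" using assms by blast
      then have "\<not> modulus gdvd 2 * z"
        using z odd_prime_factor.comaximal_2[OF factor] exact_orders_not_killed[of h z i 2] by blast
      then have "residue modulus z \<noteq> residue modulus (- z)"
        using z by (simp add: residue_eq_iff)
      then show ?thesis using z by simp
    qed
    show "P \<inter> P' = {}" if P: "P \<in> ?pair ` ?Z" "P' \<in> ?pair ` ?Z" "P \<noteq> P'" for P P'
    proof -
      obtain z where z1: "z \<in> ?Z" "P = ?pair z" using P(1) by (rule imageE)
      obtain z' where z2: "z' \<in> ?Z" "P' = ?pair z'" using P(2) by (rule imageE)
      note z = z1(1) z2(1) z1(2) z2(2)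
      then have "\<chi> z \<noteq> \<chi> z'" using \<chi>[OF z(1,2)] P(3) by simp
      then have "\<not> modulus gdvd z - z'" "\<not> modulus gdvd z + z'"
        using \<chi>_eq_iff[of z z'] z(1,2) by simp_all
      then show ?thesis using res[OF z(1,2)] unfolding z(3,4) by auto
    qed
  qed
  then show "2 * card (stratum h) = card (residue modulus ` ?Z)"
    unfolding un card_pair stratum_eq[OF assms] .
  have "finite (?pair ` ?Z)" by (rule finite_UnionD) (simp only: un fin)
  then show "finite (stratum h)"
    unfolding stratum_eq[OF assms] using image_same_fibers(2)[of ?Z \<chi> ?pair] \<chi> by simp
qed

text \<open>
  By the annihilator computation the common period is the least number that \<open>returns h\<close> accepts.
\<close>

lemma stratum_cycles:
  assumes h: "\<exists>i\<in>{1..w}. h i \<noteq> 0"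
  shows "\<exists>l>0. (\<forall>c\<in>cycles_in (stratum h). cycle_of_length l c) \<and>
           2 * (l * card (cycles_in (stratum h)))
             = card (residue modulus ` {z \<in> gauss_int. exact_orders h z})"
proof (cases "stratum h = {}")
  case True
  then have "cycles_in (stratum h) = {}" unfolding cycles_in_eq using self_in_orbit by blast
  \<comment> \<open>no cycles at all: every \<open>l\<close> is a common length\<close>
  then show ?thesis using card_stratum[OF h] True by (intro exI[of _ 1]) auto
next
  case False
  define l where "l = (LEAST k. returns h k)"
  have S: "periodic x \<and> period x = l" if x: "x \<in> stratum h" for x
  proof -
    obtain z where z: "z \<in> gauss_int" "exact_orders h z" "x = \<chi> z"
      using x unfolding stratum_def by auto
    then have "rho ^ e 0 gdvd z" unfolding exact_orders_def by blast
    then have "periodic x" using z periodic_iff by blast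
    moreover have "returns h = (\<lambda>k. k \<ge> 1 \<and> (theta ^^ k) x = x)"
      unfolding z(3) by (rule ext) (rule returns_iff[OF z(2,1)])
    then have "period x = l" unfolding period_def l_def by simp
    ultimately show ?thesis ..
  qed
  have closed: "theta ` stratum h \<subseteq> stratum h"
  proof
    fix y assume "y \<in> theta ` stratum h"
    then obtain z where z: "z \<in> gauss_int" "exact_orders h z" "y = theta (\<chi> z)"
      unfolding stratum_def by auto
    then have "y = \<chi> (rho ^ 1 * z)" using theta_\<chi> by simp
    then show "y \<in> stratum h"
      unfolding stratum_eq[OF h]
      using exact_orders_rho_power[OF z(2,1), of 1] rho_power_mult_gauss_int[OF z(1), of 1] by blast
  qed
  note cyc = card_cycles_in[OF card_stratum(2)[OF h] closed S]
  obtain x where "x \<in> stratum h" using False by blast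
  then have "l > 0" using S[of x] period_least(1)[of x] by auto
  then show ?thesis using cyc card_stratum(1)[OF h] by (intro exI[of _ l]) auto
qed

end

section \<open>Quotients of the ring of Gaussian integers\<close>

lemma gauss_ring_simps [simp]:
  "carrier gauss_ring = gauss_int" "x \<otimes>\<^bsub>gauss_ring\<^esub> y = x * y" "x \<oplus>\<^bsub>gauss_ring\<^esub> y = x + y"
  "\<one>\<^bsub>gauss_ring\<^esub> = 1" "\<zero>\<^bsub>gauss_ring\<^esub> = 0"
  by (simp_all add: gauss_ring_def gauss_int_def)

lemma gauss_ring_cring: "cring gauss_ring"
proof (rule cringI)
  show "abelian_group gauss_ring"
  proof (rule abelian_groupI)
    fix x assume "x \<in> carrier gauss_ring"
    then show "\<exists>y\<in>carrier gauss_ring. y \<oplus>\<^bsub>gauss_ring\<^esub> x = \<zero>\<^bsub>gauss_ring\<^esub>"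
      by (intro bexI[of _ "- x"]) auto
  qed auto
  show "comm_monoid gauss_ring"
    by (rule comm_monoidI) auto
qed (auto simp: distrib_right)

lemma gauss_divides_iff: "a divides\<^bsub>gauss_ring\<^esub> b \<longleftrightarrow> a gdvd b"
  by (simp add: factor_def gdvd_def)

lemma gauss_associated_iff: "a \<sim>\<^bsub>gauss_ring\<^esub> b \<longleftrightarrow> a gdvd b \<and> b gdvd a"
  by (simp add: associated_def gauss_divides_iff)

lemma gauss_principal_ideal: "d \<in> gauss_int \<Longrightarrow> ideal (PIdl\<^bsub>gauss_ring\<^esub> d) gauss_ring"
  using cring.cgenideal_ideal[OF gauss_ring_cring] by simp

lemma gauss_coset: "PIdl\<^bsub>gauss_ring\<^esub> d +>\<^bsub>gauss_ring\<^esub> z = residue d z"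
  by (auto simp: a_r_coset_def' cgenideal_def residue_def mult.commute add.commute)

lemma gauss_quot_carrier: "carrier (gauss_quot d) = residues d"
  by (auto simp: FactRing_def A_RCOSETS_def' gauss_coset residues_def)

lemma gauss_quot_zero: "d \<in> gauss_int \<Longrightarrow> \<zero>\<^bsub>gauss_quot d\<^esub> = residue d 0"
  by (auto simp: FactRing_def cgenideal_def residue_def mult.commute)

lemma gauss_quot_add:
  assumes "d \<in> gauss_int" "x \<in> gauss_int" "y \<in> gauss_int"
  shows "residue d x \<oplus>\<^bsub>gauss_quot d\<^esub> residue d y = residue d (x + y)"
proof -
  have "abelian_subgroup (PIdl\<^bsub>gauss_ring\<^esub> d) gauss_ring"
    using gauss_principal_ideal[OF assms(1)]
    by (simp add: abelian_subgroupI3 ideal.axioms(1) ideal_def ring.is_abelian_group)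
  then show ?thesis
    using abelian_subgroup.a_rcos_sum[of "PIdl\<^bsub>gauss_ring\<^esub> d" gauss_ring x y] assms
    by (simp add: FactRing_def gauss_coset)
qed

lemma gauss_quot_mult:
  assumes "d \<in> gauss_int" "x \<in> gauss_int" "y \<in> gauss_int"
  shows "residue d x \<otimes>\<^bsub>gauss_quot d\<^esub> residue d y = residue d (x * y)"
  using ideal.rcoset_mult_add[OF gauss_principal_ideal[OF assms(1)], of x y] assms
  by (simp add: FactRing_def gauss_coset)

lemma proj_mod_residue:
  assumes "d gdvd m"
  shows "proj_mod d (residue m z) = residue d z"
proof -
  obtain k where k: "k \<in> gauss_int" "m = d * k" using assms unfolding gdvd_def by auto
  have "proj_mod d (residue m z) = {z + m * a + b * d | a b. a \<in> gauss_int \<and> b \<in> gauss_int}"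
    unfolding proj_mod_def set_add_def' residue_def cgenideal_def by auto
  also have "\<dots> = residue d z"
  proof
    have "z + m * a + b * d = z + d * (k * a + b)" for a b
      using k by (simp add: algebra_simps)
    then show "{z + m * a + b * d | a b. a \<in> gauss_int \<and> b \<in> gauss_int} \<subseteq> residue d z"
      unfolding residue_def using k(1) by auto
    have "z + d * b = z + m * 0 + b * d" for b by (simp add: mult.commute)
    then show "residue d z \<subseteq> {z + m * a + b * d | a b. a \<in> gauss_int \<and> b \<in> gauss_int}"
      unfolding residue_def using gauss_int_closed(1) by fast
  qed
  finally show ?thesis .
qed

text \<open>
  As \<open>p\<close> is prime, the order is \<open>p ^ h\<close> as soon as it divides \<open>p ^ h\<close> but not \<open>p ^ (h - 1)\<close>.
\<close>

lemma ord_residue_iff: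
  assumes "d \<in> gauss_int" "z \<in> gauss_int" "Factorial_Ring.prime (p::nat)"
  shows "group.ord (add_monoid (gauss_quot d)) (residue d z) = p ^ h \<longleftrightarrow> has_order_exponent d p h z"
proof -
  let ?Q = "add_monoid (gauss_quot d)"
  have ring: "ring (gauss_quot d)"
    using ideal.quotient_is_ring[OF gauss_principal_ideal[OF assms(1)]] .
  interpret Q: group ?Q
    using ring abelian_group.a_group ring.is_abelian_group by blast
  have mem: "residue d z \<in> carrier ?Q"
    using assms by (simp add: gauss_quot_carrier residues_def)
  have pow: "residue d z [^]\<^bsub>?Q\<^esub> n = residue d (of_nat n * z)" for n :: nat
  proof (induction n)
    case 0
    then show ?case using assms by (simp add: gauss_quot_zero)
  next
    case (Suc n)
    then show ?case
      using gauss_quot_add[of d "of_nat n * z" z] assms by (simp add: algebra_simps)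
  qed
  have dvd: "Q.ord (residue d z) dvd n \<longleftrightarrow> d gdvd of_nat n * z" for n
    using Q.pow_eq_id[OF mem, of n] pow assms residue_eq_iff[of "of_nat n * z" 0 d]
    by (simp add: gauss_quot_zero)
  have "Q.ord (residue d z) = p ^ h \<longleftrightarrow>
      Q.ord (residue d z) dvd p ^ h \<and> (h = 0 \<or> \<not> Q.ord (residue d z) dvd p ^ (h - 1))" (is "?o = _ \<longleftrightarrow> _")
  proof
    assume "?o = p ^ h"
    then show "?o dvd p ^ h \<and> (h = 0 \<or> \<not> ?o dvd p ^ (h - 1))"
      using assms(3) prime_gt_1_nat[of p] by (auto dest!: power_dvd_imp_le)
  next
    assume a: "?o dvd p ^ h \<and> (h = 0 \<or> \<not> ?o dvd p ^ (h - 1))"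
    then obtain k where k: "k \<le> h" "?o = p ^ k" using assms(3) divides_primepow_nat by blast
    have "\<not> k < h"
    proof
      assume "k < h"
      then have "?o dvd p ^ (h - 1)" using k by (simp add: le_imp_power_dvd)
      then show False using a \<open>k < h\<close> by auto
    qed
    then show "?o = p ^ h" using k by simp
  qed
  then show ?thesis unfolding dvd has_order_exponent_def by simp
qed

section \<open>The prime factors of the modulus\<close>

lemma gauss_ring_primeD:
  assumes "ring_prime\<^bsub>gauss_ring\<^esub> q" "q \<in> gauss_int"
  shows "q \<noteq> 0" "\<not> q gdvd 1"
    and "\<And>a b. a \<in> gauss_int \<Longrightarrow> b \<in> gauss_int \<Longrightarrow> q gdvd a * b \<Longrightarrow> q gdvd a \<or> q gdvd b"
proof -
  have "q \<noteq> 0" "q \<notin> Units gauss_ring"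
    "\<forall>a\<in>gauss_int. \<forall>b\<in>gauss_int. q gdvd a * b \<longrightarrow> q gdvd a \<or> q gdvd b"
    using assms unfolding ring_prime_def Divisibility.prime_def gauss_divides_iff by simp_all
  moreover have "q \<in> Units gauss_ring" if "q gdvd 1"
    using that assms(2) unfolding gdvd_def Units_def by (auto simp: mult.commute)
  ultimately show "q \<noteq> 0" "\<not> q gdvd 1"
    "\<And>a b. a \<in> gauss_int \<Longrightarrow> b \<in> gauss_int \<Longrightarrow> q gdvd a * b \<Longrightarrow> q gdvd a \<or> q gdvd b"
    by auto
qed

text \<open>
  2 divides the product of \<open>rho\<close> and \<open>- 1 - \<i>\<close> but neither factor, so it is not prime among the Gaussian integers.
\<close>

lemma rational_prime_in_gauss_odd:
  assumes "ring_prime\<^bsub>gauss_ring\<^esub> (of_nat p)" "Factorial_Ring.prime p"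
  shows "odd p"
proof
  assume "even p"
  then have p: "p = 2"
    using prime_odd_nat[OF assms(2)] prime_ge_2_nat[OF assms(2)] by linarith
  have "(2::complex) gdvd rho * (- 1 - \<i>)"
    unfolding gdvd_def by (rule bexI[of _ 1]) (auto simp: algebra_simps)
  then have "(2::complex) gdvd rho \<or> (2::complex) gdvd - 1 - \<i>"
    using gauss_ring_primeD(3)[OF assms(1), of rho "- 1 - \<i>"] p by auto
  moreover have "\<not> (2::complex) gdvd z" if z: "Re z = - 1" for z
  proof
    assume "(2::complex) gdvd z"
    then obtain k where k: "k \<in> gauss_int" "z = 2 * k" unfolding gdvd_def by auto
    then obtain a b where "k = of_int a + \<i> * of_int b" using gauss_int_obtain by blast
    then have "of_int (2 * a) = (of_int (- 1) :: real)" using z k by simp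
    then have "2 * a = - 1" by (simp only: of_int_eq_iff)
    then show False by presburger
  qed
  ultimately show False by auto
qed

text \<open>
  A prime of norm 2 divides \<open>\<i> * rho ^ 2 = 2\<close>, hence \<open>rho\<close>, and is then associated to \<open>rho\<close> by comparing
  norms.
\<close>

lemma split_prime_odd:
  assumes r: "r \<in> gauss_int" "r * cnj r = of_nat p" "Factorial_Ring.prime p"
    and prime: "ring_prime\<^bsub>gauss_ring\<^esub> r" and not_rho: "\<not> r \<sim>\<^bsub>gauss_ring\<^esub> rho"
  shows "odd p"
proof
  assume "even p"
  then have "p = 2"
    using prime_odd_nat[OF r(3)] prime_ge_2_nat[OF r(3)] by linarith
  then have p: "r * cnj r = 2" using r(2) by simp
  have rho: "rho \<in> gauss_int" by auto
  have "rho * (\<i> * rho) = 2" by (simp add: algebra_simps)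
  then have "r gdvd rho * (\<i> * rho)" using p r by (metis gauss_int_closed(11) gdvd_triv(1))
  then have "r gdvd rho \<or> r gdvd \<i> * rho"
    using gauss_ring_primeD(3)[OF prime r(1)] rho by (meson gauss_int_closed(3,9))
  moreover have "rho = (- \<i>) * (\<i> * rho)" by simp
  ultimately have dvd: "r gdvd rho" using gdvd_mult by (metis gauss_int_closed(3,10))
  then obtain k where k: "k \<in> gauss_int" "rho = r * k" unfolding gdvd_def by auto
  have "(r * cnj r) * (k * cnj k) = (r * k) * cnj (r * k)" by (simp add: mult_ac)
  also have "\<dots> = rho * cnj rho" by (simp only: k(2))
  also have "\<dots> = 2" by (simp add: complex_eq_iff)
  finally have unit: "k * cnj k = 1" by (simp only: p) simp
  have "rho * cnj k = r * (k * cnj k)" by (simp only: k(2) mult.assoc)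
  then have "r = rho * cnj k" by (simp only: unit mult_1_right)
  then have "rho gdvd r" using k(1) by (metis gauss_int_closed(11) gdvd_triv(1))
  then show False using dvd not_rho gauss_associated_iff by blast
qed

text \<open>
  The ideal generated by \<open>r\<close> and \<open>cnj r\<close> contains the trace \<open>2 * a\<close> and the norm \<open>p = a ^ 2 + b ^ 2\<close>,
  which are coprime: otherwise \<open>p\<close> would divide \<open>a\<close> and \<open>b\<close>, and \<open>p ^ 2\<close> would divide \<open>p\<close>.
\<close>

lemma split_prime_comaximal_cnj:
  assumes r: "r \<in> gauss_int" "r * cnj r = of_nat p" "Factorial_Ring.prime p" and odd: "odd p"
  shows "comaximal (cnj r) r"
proof -
  obtain a b where ab: "r = of_int a + \<i> * of_int b" using r(1) gauss_int_obtain by blast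
  have "of_int (a ^ 2 + b ^ 2) = r * cnj r"
    unfolding ab by (simp add: complex_eq_iff power2_eq_square)
  also have "\<dots> = of_int (int p)" using r(2) by simp
  finally have norm: "a ^ 2 + b ^ 2 = int p" by (simp only: of_int_eq_iff)
  have prime: "Factorial_Ring.prime (int p)" using r(3) by simp
  have "\<not> int p dvd a"
  proof
    assume a: "int p dvd a"
    then have "int p dvd a ^ 2" by (simp add: power2_eq_square)
    moreover have "b ^ 2 = int p - a ^ 2" using norm by simp
    ultimately have "int p dvd b ^ 2" by simp
    then have "int p dvd b" using prime prime_dvd_power by blast
    then have "int p ^ 2 dvd a ^ 2 + b ^ 2" using a by (intro dvd_add dvd_power_same)
    then have "int p * int p dvd int p * 1" unfolding norm by (simp add: power2_eq_square)
    then have "int p dvd 1" using prime by (subst (asm) dvd_mult_cancel_left) auto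
    then show False using prime not_prime_unit by blast
  qed
  then have "coprime a (int p)" using prime prime_imp_coprime coprime_commute by blast
  moreover have "coprime 2 (int p)" using odd by simp
  ultimately have "coprime (2 * a) (int p)" by simp
  then have "comaximal (of_int (2 * a)) (of_int (int p))" by (rule comaximal_of_coprime)
  moreover have "of_int (2 * a) = r + cnj r" unfolding ab by (simp add: complex_eq_iff)
  moreover have "of_int (int p) = r * cnj r" using r(2) by simp
  ultimately have "comaximal (r + cnj r) (r * cnj r)" by simp
  then obtain x y where g: "x \<in> gauss_int" "y \<in> gauss_int"
    and e: "x * (r + cnj r) + y * (r * cnj r) = 1"
    unfolding comaximal_def by auto
  have "x * cnj r + (x + y * cnj r) * r = 1" unfolding e[symmetric] by (simp add: algebra_simps)
  moreover have "x + y * cnj r \<in> gauss_int" using g r by auto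
  ultimately show ?thesis unfolding comaximal_def using g by blast
qed

text \<open>
  Two primes of the same norm \<open>p\<close>: \<open>s\<close> divides \<open>r\<close> or \<open>cnj r\<close>. The first would make it associated to
  \<open>r\<close>, and the second makes it comaximal to \<open>r\<close>, as \<open>cnj r\<close> is.
\<close>

lemma split_primes_comaximal:
  assumes r: "r \<in> gauss_int" "r * cnj r = of_nat p" "Factorial_Ring.prime p" "odd p"
    and s: "s \<in> gauss_int" "s * cnj s = of_nat p" "ring_prime\<^bsub>gauss_ring\<^esub> s"
    and not_assoc: "\<not> r \<sim>\<^bsub>gauss_ring\<^esub> s"
  shows "comaximal r s"
proof -
  have p: "p > 0" using r(3) prime_gt_0_nat by blast
  have unit: "t = s * k \<Longrightarrow> t * cnj t = of_nat p \<Longrightarrow> s = t * cnj k" for t k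
  proof -
    assume t: "t = s * k" "t * cnj t = of_nat p"
    then have "(s * cnj s) * (k * cnj k) = of_nat p" by (simp add: mult_ac)
    then have "k * cnj k = 1" using s(2) p by simp
    then show "s = t * cnj k" using t by (simp add: mult.assoc)
  qed
  have "s gdvd r * cnj r" using s r by (metis gauss_int_closed(11) gdvd_triv(1))
  then have "s gdvd r \<or> s gdvd cnj r"
    using gauss_ring_primeD(3)[OF s(3,1)] r(1) gauss_int_closed(11) by blast
  moreover have "\<not> s gdvd r"
  proof
    assume sr: "s gdvd r"
    then obtain k where k: "k \<in> gauss_int" "r = s * k" unfolding gdvd_def by auto
    then have "s = r * cnj k" using unit r(2) by blast
    then have "r gdvd s" using k(1) by (metis gauss_int_closed(11) gdvd_triv(1))
    then show False using sr not_assoc gauss_associated_iff by blast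
  qed
  ultimately obtain k where k: "k \<in> gauss_int" "cnj r = s * k" unfolding gdvd_def by auto
  then have "s gdvd cnj r" using gdvd_triv(1) by simp
  then have "comaximal s r"
    using comaximal_gdvd split_prime_comaximal_cnj[OF r] by blast
  then show ?thesis by (rule comaximal_sym)
qed

lemma inert_prime_not_norm:
  assumes "ring_prime\<^bsub>gauss_ring\<^esub> (of_nat p)" "r \<in> gauss_int"
  shows "r * cnj r \<noteq> of_nat p"
proof
  assume r: "r * cnj r = of_nat p"
  have p: "of_nat p \<noteq> (0::complex)" "\<not> of_nat p gdvd 1"
    using gauss_ring_primeD[OF assms(1)] by auto
  have unit: False if "s = of_nat p * k" "s * cnj s = of_nat p" "k \<in> gauss_int" for s k
  proof -
    have "of_nat p * (of_nat p * (k * cnj k)) = of_nat p * (1::complex)"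
      using that(1,2) by (simp add: mult_ac)
    then have "of_nat p * (k * cnj k) = 1" using p(1) mult_cancel_left by blast
    then have "of_nat p gdvd 1" using that(3) unfolding gdvd_def by (metis gauss_int_closed(9,11))
    then show False using p(2) by blast
  qed
  have "of_nat p gdvd r * cnj r" using r by simp
  then have "of_nat p gdvd r \<or> of_nat p gdvd cnj r"
    using gauss_ring_primeD(3)[OF assms(1)] assms(2) by auto
  then show False
  proof
    assume "of_nat p gdvd r"
    then show False using unit[of r] r unfolding gdvd_def by blast
  next
    assume "of_nat p gdvd cnj r"
    moreover have "cnj r * cnj (cnj r) = of_nat p" using r by (simp add: mult.commute)
    ultimately show False using unit[of "cnj r"] unfolding gdvd_def by blast
  qed
qed

definition prime_factor :: "nat \<Rightarrow> (nat \<Rightarrow> nat) \<Rightarrow> (nat \<Rightarrow> complex) \<Rightarrow> nat \<Rightarrow> complex" where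
  "prime_factor v p r i = (if i \<le> v then of_nat (p i) else r i)"

definition prime_cofactor :: "nat \<Rightarrow> (nat \<Rightarrow> complex) \<Rightarrow> nat \<Rightarrow> complex" where
  "prime_cofactor v r i = (if i \<le> v then 1 else cnj (r i))"

lemma gauss_factorization_prime_factor:
  assumes "gauss_factorization m v w p r e" "i \<in> {1..w}"
  shows "odd_prime_factor (p i) (prime_factor v p r i) (prime_cofactor v r i)"
proof (cases "i \<le> v")
  case True
  then have p: "Factorial_Ring.prime (p i)" "ring_prime\<^bsub>gauss_ring\<^esub> (of_nat (p i))"
    using assms unfolding gauss_factorization_def by auto
  show ?thesis
    using True p rational_prime_in_gauss_odd[OF p(2,1)] gauss_ring_primeD[OF p(2)]
    unfolding prime_factor_def prime_cofactor_def by unfold_locales auto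
next
  case False
  then have i: "i \<in> {v+1..w}" using assms(2) by auto
  have r: "r i \<in> gauss_int" "ring_prime\<^bsub>gauss_ring\<^esub> (r i)" "\<not> r i \<sim>\<^bsub>gauss_ring\<^esub> rho"
    "r i * cnj (r i) = of_nat (p i)" "Factorial_Ring.prime (p i)"
    using assms(1) i unfolding gauss_factorization_def by auto
  have odd: "odd (p i)" using split_prime_odd[OF r(1,4,5,2,3)] .
  show ?thesis
    using False r odd gauss_ring_primeD[OF r(2,1)] split_prime_comaximal_cnj[OF r(1,4,5) odd]
    unfolding prime_factor_def prime_cofactor_def by unfold_locales auto
qed

text \<open>
  Factors lying over different rational primes are comaximal because those primes are coprime. Over
  the same rational prime there can only be two non-associated split factors, since an inert prime
  is not a norm.
\<close>

lemma gauss_factorization_modulus: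
  assumes f: "gauss_factorization m v w p r e"
  shows "factored_modulus w p (prime_factor v p r) (prime_cofactor v r)"
proof (rule factored_modulus.intro)
  show factor: "odd_prime_factor (p i) (prime_factor v p r i) (prime_cofactor v r i)"
    if "i \<in> {1..w}" for i
    using gauss_factorization_prime_factor[OF f that] .
  fix i j assume ij: "i \<in> {1..w}" "j \<in> {1..w}" "i \<noteq> j"
  have inert: "Factorial_Ring.prime (p k)" "ring_prime\<^bsub>gauss_ring\<^esub> (of_nat (p k))" if "k \<in> {1..v}" for k
    using f that unfolding gauss_factorization_def by auto
  have split: "r k \<in> gauss_int" "ring_prime\<^bsub>gauss_ring\<^esub> (r k)"
    "r k * cnj (r k) = of_nat (p k)" "Factorial_Ring.prime (p k)" if "k \<in> {v+1..w}" for k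
    using f that unfolding gauss_factorization_def by auto
  show "comaximal (prime_factor v p r i) (prime_factor v p r j)"
  proof (cases "p i = p j")
    case False
    have dvd: "prime_factor v p r k gdvd of_int (int (p k))" if "k \<in> {1..w}" for k
      using odd_prime_factor.p_eq[OF factor[OF that]] odd_prime_factor.c[OF factor[OF that]]
      by (simp add: gdvd_triv)
    have "Factorial_Ring.prime (p i)" "Factorial_Ring.prime (p j)"
      using factor ij odd_prime_factor.p by blast+
    then have "coprime (int (p i)) (int (p j))" using False by (simp add: primes_coprime)
    then show ?thesis
      using comaximal_gdvd2[OF comaximal_of_coprime dvd[OF ij(1)] dvd[OF ij(2)]] by blast
  next
    case True
    have not_both: "\<not> (i \<le> v \<and> j \<le> v)"
    proof
      assume "i \<le> v \<and> j \<le> v"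
      then have "i \<in> {1..v}" "j \<in> {1..v}" using ij by auto
      moreover have "inj_on p {1..v}" using f unfolding gauss_factorization_def by blast
      ultimately show False using True ij(3) by (metis inj_onD)
    qed
    have not_mixed: False if "k \<in> {1..v}" "l \<in> {v+1..w}" "p k = p l" for k l
      using inert_prime_not_norm[OF inert(2)[OF that(1)] split(1)[OF that(2)]] split(3)[OF that(2)]
        that(3) by simp
    have "\<not> i \<le> v" "\<not> j \<le> v"
      using not_both not_mixed[of i j] not_mixed[of j i] True ij by auto
    then have kl: "i \<in> {v+1..w}" "j \<in> {v+1..w}" using ij by auto
    then have "\<not> r i \<sim>\<^bsub>gauss_ring\<^esub> r j"
      using f ij(3) unfolding gauss_factorization_def by blast
    moreover have "odd (p i)" using factor[OF ij(1)] odd_prime_factor.p(2) by blast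
    ultimately have "comaximal (r i) (r j)"
      using split_primes_comaximal[of "r i" "p i" "r j"] split[OF kl(1)] split[OF kl(2)] True by simp
    then show ?thesis
      unfolding prime_factor_def using \<open>\<not> i \<le> v\<close> \<open>\<not> j \<le> v\<close> by simp
  qed
qed

lemma gauss_factorization_associated:
  assumes "gauss_factorization m v w p r e"
  shows "m gdvd factored_modulus.modulus w e (prime_factor v p r)"
    and "factored_modulus.modulus w e (prime_factor v p r) gdvd m"
proof -
  let ?q = "prime_factor v p r"
  have vw: "v \<le> w" using assms unfolding gauss_factorization_def by blast
  have "(\<Prod>i\<in>{1..w}. ?q i ^ e i) = (\<Prod>i\<in>{1..v}. ?q i ^ e i) * (\<Prod>i\<in>{v+1..w}. ?q i ^ e i)"
    using vw by (subst prod.union_disjoint[symmetric]) (auto intro!: prod.cong)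
  also have "(\<Prod>i\<in>{1..v}. ?q i ^ e i) = (\<Prod>i\<in>{1..v}. of_nat (p i) ^ e i)"
    by (intro prod.cong) (auto simp: prime_factor_def)
  also have "(\<Prod>i\<in>{v+1..w}. ?q i ^ e i) = (\<Prod>i\<in>{v+1..w}. r i ^ e i)"
    by (intro prod.cong) (auto simp: prime_factor_def)
  finally have "factored_modulus.modulus w e ?q
      = rho ^ e 0 * (\<Prod>i\<in>{1..v}. of_nat (p i) ^ e i) * (\<Prod>i\<in>{v+1..w}. r i ^ e i)"
    unfolding factored_modulus.modulus_def[OF gauss_factorization_modulus[OF assms]]
    by (simp only: mult.assoc)
  then show "m gdvd factored_modulus.modulus w e ?q" "factored_modulus.modulus w e ?q gdvd m"
    using assms unfolding gauss_factorization_def gauss_associated_iff by simp_all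
qed

lemma has_orders_residue_iff:
  assumes f: "gauss_factorization m v w p r e" and z: "z \<in> gauss_int"
  shows "has_orders v w p r e h (residue m z)
           \<longleftrightarrow> factored_modulus.exact_orders w p e (prime_factor v p r) h z"
proof -
  let ?q = "prime_factor v p r"
  interpret F: factored_modulus w p e ?q "prime_cofactor v r"
    using gauss_factorization_modulus[OF f] .
  have m: "F.modulus gdvd m" using gauss_factorization_associated[OF f] by blast
  have "F.modulus \<in> gauss_int"
    unfolding F.modulus_def
    by (intro gauss_int_closed F.odd_part_gauss_int gauss_int_power F.rho_gauss_int)
  then have dvd: "rho ^ e 0 gdvd m" "\<And>i. i \<in> {1..w} \<Longrightarrow> ?q i ^ e i gdvd m"
    using F.modulus_gdvd_iff[of F.modulus] gdvd_trans[OF _ m] by auto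
  have "rho ^ e 0 \<in> gauss_int" by (intro gauss_int_power F.rho_gauss_int)
  then have "proj_mod (rho ^ e 0) (residue m z) = \<zero>\<^bsub>gauss_quot (rho ^ e 0)\<^esub> \<longleftrightarrow> rho ^ e 0 gdvd z"
    using residue_eq_iff[OF z gauss_int_closed(1), of "rho ^ e 0"]
    by (simp only: proj_mod_residue[OF dvd(1)] gauss_quot_zero diff_0_right)
  moreover have "group.ord (add_monoid (gauss_quot (prime_power v p r e i)))
        (proj_mod (prime_power v p r e i) (residue m z)) = p i ^ h i
      \<longleftrightarrow> has_order_exponent (?q i ^ e i) (p i) (h i) z" if i: "i \<in> {1..w}" for i
  proof -
    have "prime_power v p r e i = ?q i ^ e i" unfolding prime_power_def prime_factor_def ..
    moreover have "Factorial_Ring.prime (p i)"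
      using F.factor[OF i] odd_prime_factor.p(1) by blast
    ultimately show ?thesis
      using i z by (simp only: proj_mod_residue[OF dvd(2)[OF i]] ord_residue_iff F.q_gauss_int gauss_int_power)
  qed
  ultimately show ?thesis unfolding has_orders_def F.exact_orders_def by simp
qed

lemma card_exact_orders_formula:
  assumes f: "gauss_factorization m v w p r e" and h: "h \<in> H_set w e"
  shows "card (residue (factored_modulus.modulus w e (prime_factor v p r)) `
             {z \<in> gauss_int. factored_modulus.exact_orders w p e (prime_factor v p r) h z})
           = (\<Prod>i=1..v. N_h (p i) (h i)) * (\<Prod>i=v+1..w. totient (p i ^ h i))"
proof -
  let ?q = "prime_factor v p r"
  interpret F: factored_modulus w p e ?q "prime_cofactor v r"
    using gauss_factorization_modulus[OF f] .
  let ?g = "\<lambda>i. card (residues (?q i)) ^ h i - (if h i = 0 then 0 else card (residues (?q i)) ^ (h i - 1))"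
  have vw: "v \<le> w" using f unfolding gauss_factorization_def by blast
  have "(\<Prod>i\<in>{1..w}. ?g i) = (\<Prod>i\<in>{1..v}. ?g i) * (\<Prod>i\<in>{v+1..w}. ?g i)"
    using vw by (subst prod.union_disjoint[symmetric]) (auto intro!: prod.cong)
  also have "(\<Prod>i\<in>{1..v}. ?g i) = (\<Prod>i=1..v. N_h (p i) (h i))"
  proof (rule prod.cong)
    fix i assume i: "i \<in> {1..v}"
    then have "Factorial_Ring.prime (p i)" using f unfolding gauss_factorization_def by blast
    then have "card (residues (?q i)) = p i ^ 2"
      using i residues_of_nat(2)[of "p i"] prime_gt_0_nat by (simp add: prime_factor_def)
    then show "?g i = N_h (p i) (h i)" by (simp add: N_h_def flip: power_mult)
  qed simp
  also have "(\<Prod>i\<in>{v+1..w}. ?g i) = (\<Prod>i=v+1..w. totient (p i ^ h i))"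
  proof (rule prod.cong)
    fix i assume i: "i \<in> {v+1..w}"
    then have r: "r i \<in> gauss_int" "r i * cnj (r i) = of_nat (p i)" and p: "Factorial_Ring.prime (p i)"
      using f unfolding gauss_factorization_def by auto
    have card: "card (residues (?q i)) = p i"
      using i card_residues_prime_norm[OF r] p prime_gt_0_nat by (simp add: prime_factor_def)
    show "?g i = totient (p i ^ h i)"
    proof (cases "h i")
      case 0
      then show ?thesis by simp
    next
      case (Suc k)
      then show ?thesis
        using totient_prime_power_Suc[OF p, of k] by (simp add: card algebra_simps)
    qed
  qed simp
  finally show ?thesis using F.card_exact_orders[OF h] by simp
qed

section \<open>Transport along a module isomorphism\<close>

fun neg_point :: "'a::field point \<Rightarrow> 'a point" where
  "neg_point Infpt = Infpt"
| "neg_point (Aff x y) = Aff x (- y)"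

text \<open>
  In a set of points that is a group under the chord-tangent law, this identifies the inverse of a
  point as its reflection.
\<close>

lemma ell_add_eq_Infpt: "ell_add P Q = Infpt \<Longrightarrow> P = neg_point Q"
  by (cases P; cases Q) (auto simp: Let_def split: if_splits)

lemma xcoord_eq_iff:
  assumes "P \<in> curve UNIV" "Q \<in> curve UNIV"
  shows "xcoord P = xcoord Q \<longleftrightarrow> P = Q \<or> P = neg_point Q"
proof
  assume eq: "xcoord P = xcoord Q"
  show "P = Q \<or> P = neg_point Q"
  proof (cases Q)
    case Infpt
    then show ?thesis using eq by (cases P) auto
  next
    case (Aff x y)
    then obtain y' where "P = Aff x y'" using eq by (cases P) auto
    then have "y' ^ 2 = y ^ 2" using assms Aff by (auto simp: curve_def)
    then show ?thesis using Aff \<open>P = Aff x y'\<close> by (auto simp: power2_eq_iff)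
  qed
next
  assume "P = Q \<or> P = neg_point Q"
  then show "xcoord P = xcoord Q" by (cases Q) auto
qed

lemma xcoord_rho_map: "xcoord (rho_map P) = theta (xcoord P)"
  by (cases P) (auto simp: field_simps power2_eq_square)

text \<open>
  A module isomorphism onto the quotient by \<open>m\<close> gives every point of \<open>M\<close> a Gaussian integer as
  coordinate, determined modulo \<open>m\<close>.
\<close>

locale point_coordinates =
  fixes \<iota> :: "complex \<Rightarrow> 'a::alg_closed_field point \<Rightarrow> 'a point"
    and M :: "'a point set" and m :: complex and \<psi> :: "'a point \<Rightarrow> complex set"
  assumes identification: "gauss_identification \<iota>"
    and iso: "\<psi> \<in> module_iso gauss_ring (point_module \<iota> M) (quot_module m)"
    and M_subset: "M \<subseteq> curve UNIV" and m_gauss_int [simp]: "m \<in> gauss_int"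
begin

lemma modules: "module gauss_ring (point_module \<iota> M)" "module gauss_ring (quot_module m)"
  using iso unfolding module_iso_def by auto

lemma hom: "\<psi> \<in> hom (add_monoid (point_module \<iota> M)) (add_monoid (quot_module m))"
  using iso unfolding module_iso_def Group.iso_def by auto

lemma bij: "bij_betw \<psi> M (residues m)"
  using iso unfolding module_iso_def Group.iso_def
  by (auto simp: point_module_def quot_module_def gauss_quot_carrier)

lemma groups: "abelian_group (point_module \<iota> M)" "abelian_group (quot_module m)"
  using modules module.axioms(2) by blast+

lemma \<psi>_Infpt: "Infpt \<in> M" "\<psi> Infpt = residue m 0"
proof -
  show "Infpt \<in> M"
    using abelian_monoid.zero_closed[OF abelian_group.axioms(1)[OF groups(1)]]
    by (simp add: point_module_def)
  show "\<psi> Infpt = residue m 0"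
    using hom_one[OF hom abelian_group.a_group[OF groups(1)] abelian_group.a_group[OF groups(2)]]
    by (simp add: point_module_def quot_module_def gauss_quot_zero)
qed

lemma \<psi>_add:
  assumes "P \<in> M" "Q \<in> M" "\<psi> P = residue m x" "\<psi> Q = residue m y" "x \<in> gauss_int" "y \<in> gauss_int"
  shows "\<psi> (ell_add P Q) = residue m (x + y)"
  using hom_mult[OF hom, of P Q] assms gauss_quot_add[of m x y]
  by (simp add: point_module_def quot_module_def)

lemma \<psi>_neg_point:
  assumes T: "T \<in> M" "\<psi> T = residue m z" "z \<in> gauss_int"
  shows "neg_point T \<in> M" "\<psi> (neg_point T) = residue m (- z)"
proof -
  obtain U where U: "U \<in> M" "ell_add U T = Infpt"
    using abelian_group.a_inv_closed[OF groups(1), of T] abelian_group.l_neg[OF groups(1), of T] T(1)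
    unfolding point_module_def by auto
  have UT: "U = neg_point T" using U(2) by (rule ell_add_eq_Infpt)
  then show "neg_point T \<in> M" using U by simp
  have "\<psi> U \<in> residues m" using bij U(1) unfolding bij_betw_def by blast
  then obtain u where u: "u \<in> gauss_int" "\<psi> U = residue m u" unfolding residues_def by blast
  have "residue m (u + z) = residue m 0"
    using \<psi>_add[OF U(1) T(1) u(2) T(2) u(1) T(3)] U(2) \<psi>_Infpt by simp
  then have "m gdvd u - (- z)" using residue_eq_iff u T by simp
  then show "\<psi> (neg_point T) = residue m (- z)"
    using residue_eq_iff[of u "- z" m] u T UT by simp
qed

lemma \<psi>_rho_map:
  assumes T: "T \<in> M" "\<psi> T = residue m z" "z \<in> gauss_int"
  shows "rho_map T \<in> M" "\<psi> (rho_map T) = residue m (rho * z)"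
proof -
  have rho: "rho \<in> gauss_int" by auto
  have \<iota>: "\<iota> rho T = rho_map T"
    using identification T(1) M_subset unfolding gauss_identification_def by auto
  have "rho \<odot>\<^bsub>point_module \<iota> M\<^esub> T \<in> carrier (point_module \<iota> M)"
    using module.smult_closed[OF modules(1)] rho T(1) by (simp add: point_module_def)
  then show "rho_map T \<in> M" using \<iota> by (simp add: point_module_def)
  have "\<forall>s\<in>carrier gauss_ring. \<forall>x\<in>carrier (point_module \<iota> M).
      \<psi> (s \<odot>\<^bsub>point_module \<iota> M\<^esub> x) = s \<odot>\<^bsub>quot_module m\<^esub> \<psi> x"
    using iso unfolding module_iso_def by blast
  then have "\<psi> (rho \<odot>\<^bsub>point_module \<iota> M\<^esub> T) = rho \<odot>\<^bsub>quot_module m\<^esub> \<psi> T"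
    using rho T(1) by (simp add: point_module_def)
  then have "\<psi> (rho_map T) = residue m rho \<otimes>\<^bsub>gauss_quot m\<^esub> residue m z"
    using \<iota> T(2) by (simp add: point_module_def quot_module_def gauss_coset)
  then show "\<psi> (rho_map T) = residue m (rho * z)"
    using gauss_quot_mult[OF m_gauss_int rho T(3)] by simp
qed

definition point_at :: "complex \<Rightarrow> 'a point" where
  "point_at z = inv_into M \<psi> (residue m z)"

lemma point_at:
  assumes "z \<in> gauss_int"
  shows "point_at z \<in> M" "\<psi> (point_at z) = residue m z"
proof -
  have mem: "residue m z \<in> \<psi> ` M" using bij assms unfolding bij_betw_def residues_def by simp
  show "point_at z \<in> M" unfolding point_at_def using mem by (rule inv_into_into)
  show "\<psi> (point_at z) = residue m z" unfolding point_at_def using mem by (rule f_inv_into_f)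
qed

lemma point_at_unique: "T \<in> M \<Longrightarrow> \<psi> T = residue m z \<Longrightarrow> point_at z = T"
  unfolding point_at_def using bij inv_into_f_f by (metis bij_betw_def)

lemma point_at_surj:
  assumes "T \<in> M"
  obtains z where "z \<in> gauss_int" "point_at z = T"
proof -
  have "\<psi> T \<in> residues m" using bij assms unfolding bij_betw_def by blast
  then show ?thesis using that point_at_unique[OF assms] unfolding residues_def by blast
qed

lemma point_at_eq_iff:
  assumes "z \<in> gauss_int" "z' \<in> gauss_int"
  shows "point_at z = point_at z' \<longleftrightarrow> m gdvd z - z'"
  using point_at assms point_at_unique residue_eq_iff by metis

lemma
  assumes z: "z \<in> gauss_int"
  shows point_at_rho: "point_at (rho * z) = rho_map (point_at z)"
    and point_at_uminus: "point_at (- z) = neg_point (point_at z)"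
  using point_at_unique[OF \<psi>_rho_map[OF point_at[OF z] z]]
    point_at_unique[OF \<psi>_neg_point[OF point_at[OF z] z]] .

lemma point_at_rho_power: "z \<in> gauss_int \<Longrightarrow> point_at (rho ^ k * z) = (rho_map ^^ k) (point_at z)"
proof (induction k)
  case (Suc k)
  have "rho ^ k * z \<in> gauss_int" using Suc.prems by (intro gauss_int_closed gauss_int_power) auto
  then have "point_at (rho * (rho ^ k * z)) = rho_map (point_at (rho ^ k * z))" by (rule point_at_rho)
  then show ?case using Suc by (simp only: funpow.simps o_apply power_Suc mult.assoc)
qed simp

lemma xcoord_point_at_eq_iff:
  assumes "z \<in> gauss_int" "z' \<in> gauss_int"
  shows "xcoord (point_at z) = xcoord (point_at z') \<longleftrightarrow> m gdvd z - z' \<or> m gdvd z + z'"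
proof -
  have "point_at z \<in> curve UNIV" "point_at z' \<in> curve UNIV" using point_at assms M_subset by blast+
  then have "xcoord (point_at z) = xcoord (point_at z')
      \<longleftrightarrow> point_at z = point_at z' \<or> point_at z = point_at (- z')"
    using xcoord_eq_iff point_at_uminus assms by metis
  also have "\<dots> \<longleftrightarrow> m gdvd z - z' \<or> m gdvd z - (- z')"
    using point_at_eq_iff assms gauss_int_closed(10) by metis
  finally show ?thesis by simp
qed

text \<open>
  The abscissa of the point with coordinate \<open>z\<close> determines \<open>z\<close> modulo \<open>m\<close> up to sign, and the abscissa
  of the image under \<open>rho_map\<close> is the \<open>theta\<close> of the abscissa. Thus the abscissas of the points of \<open>M\<close> are
  an instance of the dynamics of \<open>rho\<close> up to sign.
\<close>

lemma cycles_of_abscissas: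
  assumes f: "gauss_factorization m v w p r e"
    and X: "X \<subseteq> xcoord ` M" and S: "S = {T \<in> M. xcoord T \<in> X}"
    and outside: "\<And>T. T \<in> M \<Longrightarrow> xcoord T \<notin> X \<Longrightarrow> \<exists>k. (rho_map ^^ k) T = Infpt"
  shows "cycles_in X = (\<Union>h\<in>H_set w e. C_h X S \<psi> v w p r e h) \<and>
    (\<forall>h\<in>H_set w e. (\<exists>i\<in>{1..w}. h i \<noteq> 0) \<longrightarrow>
       (\<exists>l>0. (\<forall>c\<in>C_h X S \<psi> v w p r e h. cycle_of_length l c) \<and>
          real (card (C_h X S \<psi> v w p r e h)) =
            1 / (2 * real l) * (\<Prod>i=1..v. real (N_h (p i) (h i)))
              * (\<Prod>i=v+1..w. real (totient (p i ^ h i)))))"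
proof -
  let ?q = "prime_factor v p r"
  let ?\<chi> = "\<lambda>z. xcoord (point_at z)"
  interpret F: factored_modulus w p e ?q "prime_cofactor v r"
    using gauss_factorization_modulus[OF f] .
  have m: "m gdvd x \<longleftrightarrow> F.modulus gdvd x" for x
    using gauss_factorization_associated[OF f] gdvd_trans by blast
  \<comment> \<open>\<open>m\<close> and the product of its prime powers differ by a unit, so both divide the same elements\<close>
  interpret D: signed_rho_dynamics w p e ?q "prime_cofactor v r" ?\<chi> X
  proof
    show "?\<chi> z = ?\<chi> z' \<longleftrightarrow> F.modulus gdvd z - z' \<or> F.modulus gdvd z + z'"
      if "z \<in> gauss_int" "z' \<in> gauss_int" for z z'
      using xcoord_point_at_eq_iff[OF that] m by simp
    show "theta (?\<chi> z) = ?\<chi> (rho * z)" if "z \<in> gauss_int" for z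
      using point_at_rho[OF that] xcoord_rho_map by metis
    show "X \<subseteq> ?\<chi> ` gauss_int"
    proof
      fix x assume "x \<in> X"
      then obtain T where "T \<in> M" "x = xcoord T" using X by blast
      then show "x \<in> ?\<chi> ` gauss_int" using point_at_surj by (metis imageI)
    qed
    show "\<exists>k. F.modulus gdvd rho ^ k * z" if z: "z \<in> gauss_int" "?\<chi> z \<notin> X" for z
    proof -
      obtain k where "(rho_map ^^ k) (point_at z) = Infpt" using outside point_at z by blast
      then have "point_at (rho ^ k * z) = point_at 0"
        using point_at_rho_power[OF z(1)] point_at_unique[OF \<psi>_Infpt] by simp
      moreover have "rho ^ k * z \<in> gauss_int"
        by (intro gauss_int_closed gauss_int_power F.rho_gauss_int z)
      ultimately have "m gdvd rho ^ k * z"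
        using point_at_eq_iff[of "rho ^ k * z" 0] by simp
      then show ?thesis using m by blast
    qed
  qed
  have "{x \<in> X. \<exists>T\<in>S. xcoord T = x \<and> has_orders v w p r e h (\<psi> T)} = D.stratum h" for h
  proof -
    have "(\<exists>T\<in>S. xcoord T = x \<and> has_orders v w p r e h (\<psi> T))
        \<longleftrightarrow> (\<exists>z\<in>gauss_int. ?\<chi> z = x \<and> F.exact_orders h z)" if "x \<in> X" for x
    proof
      assume "\<exists>T\<in>S. xcoord T = x \<and> has_orders v w p r e h (\<psi> T)"
      then obtain T where T: "T \<in> M" "xcoord T = x" "has_orders v w p r e h (\<psi> T)"
        unfolding S by blast
      obtain z where z: "z \<in> gauss_int" "point_at z = T" using point_at_surj[OF T(1)] by blast
      then have "F.exact_orders h z"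
        using T(3) point_at(2)[OF z(1)] has_orders_residue_iff[OF f z(1)] by simp
      then show "\<exists>z\<in>gauss_int. ?\<chi> z = x \<and> F.exact_orders h z" using z T(2) by blast
    next
      assume "\<exists>z\<in>gauss_int. ?\<chi> z = x \<and> F.exact_orders h z"
      then obtain z where z: "z \<in> gauss_int" "?\<chi> z = x" "F.exact_orders h z" by blast
      have "point_at z \<in> S" using z point_at(1)[OF z(1)] that unfolding S by simp
      moreover have "has_orders v w p r e h (\<psi> (point_at z))"
        using z(3) point_at(2)[OF z(1)] has_orders_residue_iff[OF f z(1)] by simp
      ultimately show "\<exists>T\<in>S. xcoord T = x \<and> has_orders v w p r e h (\<psi> T)" using z(2) by blast
    qed
    then show ?thesis unfolding D.stratum_def by blast
  qed
  then have C: "C_h X S \<psi> v w p r e h = cycles_in (D.stratum h)" for h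
    unfolding C_h_def by simp
  show ?thesis
  proof (intro conjI ballI impI)
    show "cycles_in X = (\<Union>h\<in>H_set w e. C_h X S \<psi> v w p r e h)" unfolding C by (rule D.cycles_in_X)
    fix h assume h: "h \<in> H_set w e" "\<exists>i\<in>{1..w}. h i \<noteq> 0"
    obtain l where l: "l > 0" "\<forall>c\<in>cycles_in (D.stratum h). cycle_of_length l c"
      "2 * (l * card (cycles_in (D.stratum h)))
         = (\<Prod>i=1..v. N_h (p i) (h i)) * (\<Prod>i=v+1..w. totient (p i ^ h i))"
      using D.stratum_cycles[OF h(2)] card_exact_orders_formula[OF f h(1)] by auto
    have "2 * real l * real (card (cycles_in (D.stratum h)))
        = (\<Prod>i=1..v. real (N_h (p i) (h i))) * (\<Prod>i=v+1..w. real (totient (p i ^ h i)))"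
      using arg_cong[OF l(3), of real] by (simp add: mult.assoc)
    then have "real (card (cycles_in (D.stratum h))) =
        1 / (2 * real l) * (\<Prod>i=1..v. real (N_h (p i) (h i)))
          * (\<Prod>i=v+1..w. real (totient (p i ^ h i)))"
      using l(1) by (simp add: field_simps)
    then show "\<exists>l>0. (\<forall>c\<in>C_h X S \<psi> v w p r e h. cycle_of_length l c) \<and>
          real (card (C_h X S \<psi> v w p r e h)) =
            1 / (2 * real l) * (\<Prod>i=1..v. real (N_h (p i) (h i)))
              * (\<Prod>i=v+1..w. real (totient (p i ^ h i)))"
      unfolding C using l(1,2) by blast
  qed
qed

end

section \<open>The abscissas of the curve and of its twist\<close>

lemma curve_subset_UNIV: "curve F \<subseteq> curve UNIV"
  by (auto simp: curve_def)

lemma A_set_eq: "A_set n = xcoord ` curve (Fq n)"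
  by (force simp: A_set_def curve_def)

text \<open>
  The chains \<open>(1, y), (2, 0), (0, 0), Infpt\<close> and \<open>(- 1, y), (3, 0), (0, 0), Infpt\<close> under \<open>rho_map\<close>
  (in characteristic 5, where \<open>2 = - 3\<close> and \<open>2 ^ 2 = - 1\<close>): the exceptional points of the twist are
  killed by \<open>rho ^ 3\<close>.
\<close>

lemma
  assumes "CHAR('a::field) = 5"
  shows curve_B_star_subset: "curve_B_star n \<subseteq> (curve UNIV :: 'a point set)"
    and rho_map_curve_B_star: "T \<in> curve_B_star n \<Longrightarrow> (rho_map ^^ 3) (T :: 'a point) = Infpt"
proof -
  have five: "(5 :: 'a) = 0" using of_nat_CHAR[where 'a = 'a] assms by simp
  have "(2 :: 'a) ^ 3 + 2 = 5 * 2" "(3 :: 'a) ^ 3 + 3 = 5 * 6" by simp_all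
  then have "(2 :: 'a) ^ 3 + 2 = 0" "(3 :: 'a) ^ 3 + 3 = 0" by (simp_all only: five mult_zero_left)
  then show "curve_B_star n \<subseteq> (curve UNIV :: 'a point set)"
    by (auto simp: curve_B_star_def curve_def)
  have x0: "rho_map (Aff 0 y) = Infpt" for y :: 'a by simp
  have "(2 :: 'a) ^ 2 + 1 = 5" "(3 :: 'a) ^ 2 + 1 = 5 * 2" by simp_all
  then have sq: "(2 :: 'a) ^ 2 + 1 = 0" "(3 :: 'a) ^ 2 + 1 = 0" by (simp_all only: five mult_zero_left)
  then have x23: "rho_map (rho_map (Aff 2 (0 :: 'a))) = Infpt" "rho_map (rho_map (Aff 3 (0 :: 'a))) = Infpt"
    by simp_all
  have "(- 2 :: 'a) = 3 - 5" by simp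
  then have "(- 2 :: 'a) = 3" by (simp only: five diff_0_right)
  then have x1: "rho_map (Aff 1 y) = Aff 2 0" "rho_map (Aff (- 1) y) = Aff 3 0" for y :: 'a
    by simp_all
  have "(rho_map ^^ 3) T = rho_map (rho_map (rho_map T))" for T :: "'a point"
    by (simp add: numeral_3_eq_3)
  then show "(rho_map ^^ 3) T = Infpt" if "T \<in> curve_B_star n" for T :: "'a point"
    using that x0 x23 x1 unfolding curve_B_star_def by (auto split: if_splits)
qed

text \<open>
  Over an abscissa 0, 2 or 3 lies only a point with ordinate 0, which belongs to the smaller field.
  The abscissas 1 and -1 are exceptional exactly when they are removed from \<open>B_set n\<close>.
\<close>

lemma curve_B_star_not_B_set:
  assumes "CHAR('a::field) = 5" "(T :: 'a point) \<in> curve_B_star n"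
  shows "xcoord T \<notin> B_set n"
proof -
  have "Fin x \<notin> B'_set n" if "x \<in> {0, 2, 3 :: 'a}" for x
  proof
    assume "Fin x \<in> B'_set n"
    then obtain y where y: "y \<notin> Fq n" "Aff x y \<in> curve UNIV"
      unfolding B'_set_def curve_def by auto
    have "Aff x 0 \<in> curve_B_star n" using that unfolding curve_B_star_def by auto
    then have "Aff x 0 \<in> curve UNIV" using curve_B_star_subset[OF assms(1)] by blast
    then have "x ^ 3 + x = 0" unfolding curve_def by auto
    then have "y ^ 2 = 0" using y(2) unfolding curve_def by auto
    then have "y = 0" by simp
    then show False using y(1) by (simp add: Fq_def)
  qed
  moreover have "Inf \<notin> B'_set n" by (simp add: B'_set_def)
  ultimately show ?thesis
    using assms(2) unfolding curve_B_star_def B_set_def by (auto split: if_splits)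
qed

theorem lemma2p3:
  fixes n :: nat
    and \<iota> :: "complex \<Rightarrow> 'a::alg_closed_field point \<Rightarrow> 'a point"
  assumes "CHAR('a) = 5"
    and "n \<ge> 1"
    and "gauss_identification \<iota>"
  shows
    "(\<forall>(\<psi> :: 'a point \<Rightarrow> complex set) v w p r e.
        \<psi> \<in> module_iso gauss_ring (point_module \<iota> (curve (Fq n))) (quot_module (pi5 ^ n - 1)) \<longrightarrow>
        gauss_factorization (pi5 ^ n - 1) v w p r e \<longrightarrow>
        cycles_in (A_set n) = (\<Union>h\<in>H_set w e. C_h (A_set n) (curve (Fq n)) \<psi> v w p r e h) \<and>
        (\<forall>h\<in>H_set w e. (\<exists>i\<in>{1..w}. h i \<noteq> 0) \<longrightarrow>
           (\<exists>l>0. (\<forall>c\<in>C_h (A_set n) (curve (Fq n)) \<psi> v w p r e h. cycle_of_length l c) \<and>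
              real (card (C_h (A_set n) (curve (Fq n)) \<psi> v w p r e h)) =
                1 / (2 * real l) * (\<Prod>i=1..v. real (N_h (p i) (h i)))
                  * (\<Prod>i=v+1..w. real (totient (p i ^ h i))))))
     \<and>
     (\<forall>(\<psi>' :: 'a point \<Rightarrow> complex set) v w p r e.
        \<psi>' \<in> module_iso gauss_ring (point_module \<iota> (curve_B n \<union> curve_B_star n))
                (quot_module (pi5 ^ n + 1)) \<longrightarrow>
        gauss_factorization (pi5 ^ n + 1) v w p r e \<longrightarrow>
        cycles_in (B_set n) = (\<Union>h\<in>H_set w e. C_h (B_set n) (curve_B n) \<psi>' v w p r e h) \<and>
        (\<forall>h\<in>H_set w e. (\<exists>i\<in>{1..w}. h i \<noteq> 0) \<longrightarrow>
           (\<exists>l>0. (\<forall>c\<in>C_h (B_set n) (curve_B n) \<psi>' v w p r e h. cycle_of_length l c) \<and>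
              real (card (C_h (B_set n) (curve_B n) \<psi>' v w p r e h)) =
                1 / (2 * real l) * (\<Prod>i=1..v. real (N_h (p i) (h i)))
                  * (\<Prod>i=v+1..w. real (totient (p i ^ h i))))))"
proof (intro conjI[where P = "\<forall>\<psi> v w p r e. _ \<psi> v w p r e"] allI impI)
  fix \<psi> :: "'a point \<Rightarrow> complex set" and v w p r e
  assume iso: "\<psi> \<in> module_iso gauss_ring (point_module \<iota> (curve (Fq n))) (quot_module (pi5 ^ n - 1))"
    and f: "gauss_factorization (pi5 ^ n - 1) v w p r e"
  interpret point_coordinates \<iota> "curve (Fq n)" "pi5 ^ n - 1" \<psi>
    by unfold_locales (use assms(3) iso curve_subset_UNIV in auto)
  show "cycles_in (A_set n) = (\<Union>h\<in>H_set w e. C_h (A_set n) (curve (Fq n)) \<psi> v w p r e h) \<and>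
        (\<forall>h\<in>H_set w e. (\<exists>i\<in>{1..w}. h i \<noteq> 0) \<longrightarrow>
           (\<exists>l>0. (\<forall>c\<in>C_h (A_set n) (curve (Fq n)) \<psi> v w p r e h. cycle_of_length l c) \<and>
              real (card (C_h (A_set n) (curve (Fq n)) \<psi> v w p r e h)) =
                1 / (2 * real l) * (\<Prod>i=1..v. real (N_h (p i) (h i)))
                  * (\<Prod>i=v+1..w. real (totient (p i ^ h i)))))"
    using f by (rule cycles_of_abscissas) (auto simp: A_set_eq)
next
  fix \<psi> :: "'a point \<Rightarrow> complex set" and v w p r e
  assume iso: "\<psi> \<in> module_iso gauss_ring (point_module \<iota> (curve_B n \<union> curve_B_star n))
                (quot_module (pi5 ^ n + 1))"
    and f: "gauss_factorization (pi5 ^ n + 1) v w p r e"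
  have B: "xcoord T \<in> B_set n" if "T \<in> curve_B n" for T :: "'a point"
    using that unfolding curve_B_def by auto
  have star: "xcoord T \<notin> B_set n" if "T \<in> curve_B_star n" for T :: "'a point"
    using curve_B_star_not_B_set[OF assms(1) that] .
  have "x \<in> xcoord ` curve_B n" if "x \<in> B_set n" for x :: "'a proj_line"
  proof -
    have "x \<in> B'_set n" using that unfolding B_set_def by (auto split: if_splits)
    then obtain a y where "x = Fin a" "y \<in> Fq (2 * n) - Fq n" "Aff a y \<in> curve (Fq (2 * n))"
      unfolding B'_set_def by blast
    then have "Aff a y \<in> curve_B n" "x = xcoord (Aff a y)" using that unfolding curve_B_def by auto
    then show ?thesis by blast
  qed
  then have B_sub: "B_set n \<subseteq> xcoord ` (curve_B n \<union> curve_B_star n :: 'a point set)" by blast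
  have "curve_B n \<subseteq> (curve UNIV :: 'a point set)"
    unfolding curve_B_def using curve_subset_UNIV by blast
  then have sub: "curve_B n \<union> curve_B_star n \<subseteq> (curve UNIV :: 'a point set)"
    using curve_B_star_subset[OF assms(1)] by blast
  interpret point_coordinates \<iota> "curve_B n \<union> curve_B_star n" "pi5 ^ n + 1" \<psi>
    by unfold_locales (use assms(3) iso sub in auto)
  show "cycles_in (B_set n) = (\<Union>h\<in>H_set w e. C_h (B_set n) (curve_B n) \<psi> v w p r e h) \<and>
        (\<forall>h\<in>H_set w e. (\<exists>i\<in>{1..w}. h i \<noteq> 0) \<longrightarrow>
           (\<exists>l>0. (\<forall>c\<in>C_h (B_set n) (curve_B n) \<psi> v w p r e h. cycle_of_length l c) \<and>
              real (card (C_h (B_set n) (curve_B n) \<psi> v w p r e h)) =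
                1 / (2 * real l) * (\<Prod>i=1..v. real (N_h (p i) (h i)))
                  * (\<Prod>i=v+1..w. real (totient (p i ^ h i)))))"
    using f B_sub
  proof (rule cycles_of_abscissas)
    show "curve_B n = {T :: 'a point. T \<in> curve_B n \<union> curve_B_star n \<and> xcoord T \<in> B_set n}"
      using B star by blast
    show "\<exists>k. (rho_map ^^ k) T = Infpt"
      if "T \<in> curve_B n \<union> curve_B_star n" "xcoord T \<notin> B_set n" for T :: "'a point"
      using that B rho_map_curve_B_star[OF assms(1)] by blast
  qed
qed

end
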